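(* Let $n\ge 4$ and let $W_n$ be the wheel graph on $n$ vertices. Then, with $\nu_n=\lceil \frac{n-4}{3}\rceil$, \[ M_1(W_n)\simeq\begin{cases} S^{\nu_n}\vee S^{\nu_n} & n\equiv 1 \pmod 3,\\ \bigvee_{n-2} S^{\nu_n} & n\equiv 2 \pmod 3,\\ \bigvee_{n} S^{\nu_n} & n\equiv 0\pmod 3,\end{cases} \] where $\bigvee_k S^d$ denotes a wedge of $k$ copies of $S^d$.
   Context: The wheel graph $W_n$ on $n$ vertices is obtained from a cycle on $n-1$ vertices by adding one new vertex adjacent to every vertex of the cycle. A matching of a graph $G$ is a set of edges in which every vertex has degree at most $1$. The matching complex $M_1(G)$ is the simplicial complex whose vertices are the edges of $G$ and whose faces are the matchings of $G$. $\simeq$ denotes homotopy equivalence. *)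

theory Defs
  imports "HOL-Analysis.Analysis"
begin

text \<open>Simple graphs are given by their edge sets; an edge is a 2-element set of vertices.\<close>

definition wheel_edges :: "nat \<Rightarrow> nat set set" where
  "wheel_edges n =
     {{0, i} | i. 1 \<le> i \<and> i \<le> n - 1}
   \<union> {{i, i + 1} | i. 1 \<le> i \<and> i < n - 1}
   \<union> {{n - 1, 1}}"

definition is_matching :: "'v set set \<Rightarrow> 'v set set \<Rightarrow> bool" where
  "is_matching E M \<longleftrightarrow> M \<subseteq> E \<and> (\<forall>e\<in>M. \<forall>e'\<in>M. e \<noteq> e' \<longrightarrow> e \<inter> e' = {})"

definition matching_complex :: "'v set set \<Rightarrow> 'v set set set" where
  "matching_complex E = {M. M \<noteq> {} \<and> is_matching E M}"

definition geom_realization :: "'a set \<Rightarrow> 'a set set \<Rightarrow> ('a \<Rightarrow> real) topology" where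
  "geom_realization V F =
     subtopology (product_topology (\<lambda>_. euclideanreal) UNIV)
       {f. (\<forall>v. 0 \<le> f v) \<and> (\<forall>v. v \<notin> V \<longrightarrow> f v = 0) \<and> sum f V = 1 \<and> {v. f v \<noteq> 0} \<in> F}"

text \<open>The i-th d-sphere: unit sphere in the coordinate block [i(d+1), (i+1)(d+1)), centred at the
  first basis vector of that block, so all such spheres pass through the origin and are otherwise
  disjoint.\<close>
definition block_sphere :: "nat \<Rightarrow> nat \<Rightarrow> (nat \<Rightarrow> real) set" where
  "block_sphere d i =
     {x. (\<forall>j. j \<notin> {i*(d+1)..<(i+1)*(d+1)} \<longrightarrow> x j = 0) \<and>
         (\<Sum>j\<in>{i*(d+1)..<(i+1)*(d+1)}. (x j - (if j = i*(d+1) then 1 else 0))^2) = 1}"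

definition wedge_spheres :: "nat \<Rightarrow> nat \<Rightarrow> (nat \<Rightarrow> real) topology" where
  "wedge_spheres k d =
     subtopology (product_topology (\<lambda>_. euclideanreal) UNIV) (\<Union>i<k. block_sphere d i)"

definition nu :: "nat \<Rightarrow> nat" where
  "nu n = nat \<lceil>(real n - 4) / 3\<rceil>"

end

theory Submission
  imports Defs
begin

text \<open>
  Let \<open>m = n - 1\<close> be the length of the rim. If the link of a face \<open>\<sigma>\<close> of a complex is a cone, then
  pushing mass from the vertices of \<open>\<sigma>\<close> to the apex deformation retracts the complex onto the faces
  not containing \<open>\<sigma>\<close>. If removing \<open>k\<close> facets of dimension \<open>d\<close> from a complex leaves a contractible
  complex, then collapsing the latter to a point exhibits the complex as a wedge of \<open>k\<close> copies of
  the \<open>d\<close>-sphere. So it suffices to find facets of dimension \<open>\<nu>\<^sub>n\<close> in the matching complex, or in a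
  collapse of it, whose removal leaves a complex collapsing to a cone.

  The link of a spoke is the independence complex of a path \<open>p\<^sub>1, \<dots>, p\<^sub>L\<close> with \<open>L = m - 2\<close>. There
  \<open>p\<^sub>3, p\<^sub>6, \<dots>\<close> can be removed successively, with apexes \<open>p\<^sub>1, p\<^sub>4, \<dots>\<close>. For \<open>L \<equiv> 1\<close> modulo 3 the
  last vertex becomes an apex and the spoke can be removed; otherwise what is left is the boundary
  of a cross-polytope on the pairs \<open>{p\<^sub>1, p\<^sub>2}, {p\<^sub>4, p\<^sub>5}, \<dots>\<close>, and the spoke can be removed as soon as
  one facet is. Rim edges are removed in the same way until a path remains.
\<close>

subsection \<open>Geometric realizations and collapses\<close>

text \<open>The residue of \<open>m\<close> modulo 3 decides which facets are removed. For
  \<open>m = 3 k\<close> every spoke goes without cost, and the two spheres come from the rim cycle,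
  carried by two of its three faces \<open>{c r, c (r + 3), ...}\<close>. For
  \<open>m = 3 k + 1\<close> every spoke except \<open>s 0\<close> costs one facet, which gives
  \<open>m - 1\<close> spheres; \<open>s 0\<close> is spared because it becomes the apex of the
  final cone. For \<open>m = 3 k + 2\<close> every spoke costs one facet and the rim cycle costs one
  more, \<open>m + 1\<close> in all. In this last case the rim facet still extends by a spoke in the
  matching complex and becomes maximal only through the collapse; hence links are folded before
  facets are removed. The quotient by the contractible part is realized by an explicit formula, so
  that its target is the prescribed union of spheres itself and not an abstract quotient
  space.\<close>

definition simplicial :: "'a set \<Rightarrow> 'a set set \<Rightarrow> bool" where
  "simplicial V K \<longleftrightarrow>
     finite V \<and> (\<forall>S\<in>K. S \<noteq> {} \<and> S \<subseteq> V) \<and> (\<forall>S\<in>K. Pow S - {{}} \<subseteq> K)"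

definition points :: "'a set \<Rightarrow> 'a set set \<Rightarrow> ('a \<Rightarrow> real) set" where
  "points V K =
     {f. (\<forall>v. 0 \<le> f v) \<and> (\<forall>v. v \<notin> V \<longrightarrow> f v = 0) \<and> sum f V = 1 \<and> {v. f v \<noteq> 0} \<in> K}"

lemma simplicialD:
  assumes "simplicial V K"
  shows "finite V" "S \<in> K \<Longrightarrow> S \<noteq> {}" "S \<in> K \<Longrightarrow> S \<subseteq> V" "S \<in> K \<Longrightarrow> finite S"
    "S \<in> K \<Longrightarrow> T \<noteq> {} \<Longrightarrow> T \<subseteq> S \<Longrightarrow> T \<in> K"
proof -
  have K: "finite V" "S \<in> K \<Longrightarrow> S \<noteq> {} \<and> S \<subseteq> V \<and> Pow S - {{}} \<subseteq> K"
    using assms by (auto simp: simplicial_def)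
  show "finite V" by fact
  show "S \<in> K \<Longrightarrow> S \<noteq> {}" and "S \<in> K \<Longrightarrow> S \<subseteq> V"
    using K(2) by simp_all
  show "S \<in> K \<Longrightarrow> finite S"
    using K finite_subset by blast
  show "S \<in> K \<Longrightarrow> T \<noteq> {} \<Longrightarrow> T \<subseteq> S \<Longrightarrow> T \<in> K"
    using K(2) by blast
qed

lemma simplicial_filter:
  assumes "simplicial V K" and "\<And>S T. S \<in> K \<Longrightarrow> P S \<Longrightarrow> T \<subseteq> S \<Longrightarrow> P T"
  shows "simplicial V {S \<in> K. P S}"
  unfolding simplicial_def
proof (intro conjI ballI subsetI)
  fix S T assume "S \<in> {S \<in> K. P S}" and "T \<in> Pow S - {{}}"
  then show "T \<in> {S \<in> K. P S}"
    using simplicialD(5)[OF assms(1), of S T] assms(2)[of S T] by simp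
qed (use simplicialD(1-3)[OF assms(1)] in auto)

lemma simplicial_finite:
  assumes "simplicial V K"
  shows "finite K"
proof (rule finite_subset)
  show "K \<subseteq> Pow V" using simplicialD(3)[OF assms] by blast
  show "finite (Pow V)" using simplicialD(1)[OF assms] by simp
qed

lemma pointsD:
  assumes "f \<in> points V K"
  shows "0 \<le> f v" "v \<notin> V \<Longrightarrow> f v = 0" "sum f V = 1" "{v. f v \<noteq> 0} \<in> K"
  using assms by (auto simp: points_def)

text \<open>It suffices to bound the support by a face: the support is nonempty because the
  coordinates sum to 1, so downward closure makes it a face.\<close>

lemma pointsI:
  assumes "simplicial V K" and "\<And>v. 0 \<le> f v" and "S \<in> K" and "\<And>v. v \<notin> S \<Longrightarrow> f v = 0"
    and "sum f V = 1"
  shows "f \<in> points V K"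
proof -
  have "{v. f v \<noteq> 0} \<noteq> {}"
  proof
    assume "{v. f v \<noteq> 0} = {}"
    then have "f v = 0" for v by auto
    then show False using assms(5) by simp
  qed
  moreover have "{v. f v \<noteq> 0} \<subseteq> S"
    using assms(4) by auto
  ultimately have "{v. f v \<noteq> 0} \<in> K"
    by (rule simplicialD(5)[OF assms(1,3)])
  moreover have "f v = 0" if "v \<notin> V" for v
    using that assms(4)[of v] simplicialD(3)[OF assms(1,3)] by blast
  ultimately show ?thesis
    using assms(2,5) by (simp add: points_def)
qed

lemma sum_over_face:
  assumes "simplicial V K" "S \<in> K" "\<And>v. v \<notin> S \<Longrightarrow> f v = 0"
  shows "sum f S = sum f V"
  by (rule sum.mono_neutral_left) (use assms(3) simplicialD(1)[OF assms(1)] simplicialD(3)[OF assms(1,2)] in auto)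

section \<open>The realization as a topological space\<close>

lemma geom_realization_points:
  "geom_realization V K = subtopology (product_topology (\<lambda>_. euclideanreal) UNIV) (points V K)"
  by (simp add: geom_realization_def points_def)

lemma topspace_geom_realization [simp]: "topspace (geom_realization V K) = points V K"
  by (simp add: geom_realization_points)

lemma continuous_map_into_geom_realization:
  "continuous_map X (geom_realization V K) f \<longleftrightarrow>
     (\<forall>v. continuous_map X euclideanreal (\<lambda>x. f x v)) \<and> f \<in> topspace X \<rightarrow> points V K"
  by (simp add: geom_realization_points continuous_map_in_subtopology continuous_map_componentwise_UNIV)

lemma continuous_map_coordinate:
  "continuous_map X (geom_realization V K) g \<Longrightarrow> continuous_map X euclideanreal (\<lambda>x. g x v)"
  by (simp add: continuous_map_into_geom_realization)

lemma continuous_map_geom_projection: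
  "continuous_map (geom_realization V K) euclideanreal (\<lambda>f. f v)"
  using continuous_map_coordinate[OF continuous_map_id] by simp

lemma continuous_map_real_Min:
  assumes "finite I" "I \<noteq> {}" "\<And>i. i \<in> I \<Longrightarrow> continuous_map X euclideanreal (\<lambda>x. f x i)"
  shows "continuous_map X euclideanreal (\<lambda>x. Min (f x ` I))"
  using assms
proof (induction I rule: finite_ne_induct)
  case (insert a I)
  then have "Min (f x ` insert a I) = min (f x a) (Min (f x ` I))" for x
    by simp
  with insert show ?case
    by (simp add: continuous_map_real_min)
qed simp

lemma Hausdorff_space_real_product:
  "Hausdorff_space (subtopology (product_topology (\<lambda>_. euclideanreal) UNIV) S)"
  by (intro Hausdorff_space_subtopology) (simp add: Hausdorff_space_product_topology)

lemma compact_geom_realization: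
  assumes K: "simplicial V K"
  shows "compact_space (geom_realization V K)"
proof -
  let ?R = "product_topology (\<lambda>_. euclideanreal) (UNIV::'a set)"
  \<comment> \<open>Having support in \<open>K\<close> is not visibly a closed condition. Having
    support inside a given face is, and finitely many faces cover the realization.\<close>
  define P where "P S = {f. (\<forall>v. 0 \<le> f v) \<and> (\<forall>v. v \<notin> S \<longrightarrow> f v = 0) \<and> sum f V = (1::real)}" for S :: "'a set"
  have eq: "points V K = (\<Union>S\<in>K. P S)"
  proof (intro set_eqI iffI)
    fix f assume f: "f \<in> points V K"
    have "f \<in> P {v. f v \<noteq> 0}" "{v. f v \<noteq> 0} \<in> K"
      using pointsD[OF f] by (auto simp: P_def)
    then show "f \<in> (\<Union>S\<in>K. P S)" by blast
  next
    fix f assume "f \<in> (\<Union>S\<in>K. P S)"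
    then show "f \<in> points V K"
      using pointsI[OF K] by (auto simp: P_def)
  qed
  have coord: "continuous_on UNIV (\<lambda>f::'a \<Rightarrow> real. f v)" for v
    by simp
  have "closed (P S)" for S
    unfolding P_def imp_conv_disj not_not
    by (intro closed_Collect_conj closed_Collect_all closed_Collect_le closed_Collect_eq closed_Collect_disj
        closed_Collect_const continuous_intros coord)
  moreover have "finite K"
    using K by (rule simplicial_finite)
  ultimately have "closed (points V K)"
    unfolding eq by auto
  then have "closedin ?R (points V K)"
    by (simp add: euclidean_product_topology)
  moreover have "compactin ?R (PiE UNIV (\<lambda>_. {0..1}))"
    by (subst compactin_PiE) auto
  moreover have "points V K \<subseteq> PiE UNIV (\<lambda>_. {0..1})"
  proof
    fix f assume f: "f \<in> points V K"
    have "f v \<le> 1" for v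
    proof (cases "v \<in> V")
      case True
      then have "f v \<le> sum f V"
        using simplicialD(1)[OF K] pointsD(1)[OF f] by (intro member_le_sum) auto
      then show ?thesis using pointsD(3)[OF f] by simp
    qed (use pointsD(2)[OF f] in simp)
    then show "f \<in> PiE UNIV (\<lambda>_. {0..1})"
      using pointsD(1)[OF f] by auto
  qed
  ultimately have "compactin ?R (points V K)"
    by (meson closed_compactin)
  then show ?thesis
    by (simp add: geom_realization_points compact_space_subtopology)
qed

text \<open>Contiguous maps: the segment from \<open>f x\<close> to \<open>g x\<close> stays in the
  simplex spanned by the union of the two supports.\<close>

lemma homotopic_contiguous:
  assumes K: "simplicial V K"
    and f: "continuous_map X (geom_realization V K) f" and g: "continuous_map X (geom_realization V K) g"
    and fg: "\<And>x. x \<in> topspace X \<Longrightarrow> {v. f x v \<noteq> 0} \<union> {v. g x v \<noteq> 0} \<in> K"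
  shows "homotopic_with (\<lambda>_. True) X (geom_realization V K) f g"
proof -
  let ?I = "top_of_set {0..1::real}"
  define h where "h = (\<lambda>(t, x) v. (1 - t) * f x v + t * g x v)"
  have t: "continuous_map (prod_topology ?I X) euclideanreal fst"
    using continuous_map_fst continuous_map_in_subtopology by blast
  have "continuous_map (prod_topology ?I X) euclideanreal (\<lambda>z. f (snd z) v)"
    "continuous_map (prod_topology ?I X) euclideanreal (\<lambda>z. g (snd z) v)" for v
    using f g
    by (auto simp: continuous_map_into_geom_realization
        intro!: continuous_map_compose[OF continuous_map_snd, unfolded o_def])
  then have "continuous_map (prod_topology ?I X) euclideanreal (\<lambda>z. h z v)" for v
    unfolding h_def case_prod_beta by (intro continuous_intros t)
  moreover have "h (t, x) \<in> points V K" if t: "0 \<le> t" "t \<le> 1" and x: "x \<in> topspace X" for t x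
  proof (rule pointsI[OF K _ fg[OF x]])
    have fx: "f x \<in> points V K" "g x \<in> points V K"
      using f g x by (auto simp: continuous_map_into_geom_realization)
    show "0 \<le> h (t, x) v" for v
      using t pointsD(1)[OF fx(1)] pointsD(1)[OF fx(2)] by (simp add: h_def)
    show "sum (h (t, x)) V = 1"
      using pointsD(3)[OF fx(1)] pointsD(3)[OF fx(2)]
      by (simp add: h_def sum.distrib flip: sum_distrib_left)
  qed (auto simp: h_def)
  ultimately have "continuous_map (prod_topology ?I X) (geom_realization V K) h"
    by (auto simp: continuous_map_into_geom_realization)
  then show ?thesis
    unfolding homotopic_with_def by (intro exI[of _ h]) (auto simp: h_def)
qed

text \<open>The identity and the constant map to the apex are contiguous.\<close>

lemma contractible_cone:
  assumes K: "simplicial V K" and a: "{a} \<in> K" and cone: "\<And>S. S \<in> K \<Longrightarrow> insert a S \<in> K"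
  shows "contractible_space (geom_realization V K)" "points V K \<noteq> {}"
proof -
  define e where "e = (\<lambda>v. if v = a then 1 else (0::real))"
  have "a \<in> V" using simplicialD(3)[OF K a] by simp
  then have e: "e \<in> points V K"
    using simplicialD(1)[OF K] by (intro pointsI[OF K _ a]) (auto simp: e_def)
  have supp: "{v. e v \<noteq> 0} = {a}" by (auto simp: e_def)
  have "homotopic_with (\<lambda>_. True) (geom_realization V K) (geom_realization V K) id (\<lambda>_. e)"
  proof (rule homotopic_contiguous[OF K])
    show "{v. id x v \<noteq> 0} \<union> {v. e v \<noteq> 0} \<in> K" if "x \<in> topspace (geom_realization V K)" for x
      using that cone pointsD(4) unfolding supp by auto
  qed (use e in auto)
  then show "contractible_space (geom_realization V K)"
    by (auto simp: contractible_space_def)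
  show "points V K \<noteq> {}" using e by auto
qed

text \<open>The retraction \<open>r\<close> takes the least coordinate \<open>m f\<close> on
  \<open>\<sigma>\<close> from every vertex of \<open>\<sigma>\<close> and gives the total to
  \<open>v\<close>. A vertex where the minimum is attained drops to 0, so \<open>\<sigma>\<close> is
  no longer in the support. If \<open>m f\<close> is nonzero, then the support contains
  \<open>\<sigma>\<close> and may be enlarged by \<open>v\<close>, so \<open>r\<close> is contiguous
  to the identity; if it is zero, \<open>r\<close> fixes \<open>f\<close>.\<close>

lemma collapse_homotopy_equivalent:
  assumes K: "simplicial V K" and \<sigma>: "\<sigma> \<noteq> {}" and v: "v \<notin> \<sigma>"
    and cone: "\<And>S. S \<in> K \<Longrightarrow> \<sigma> \<subseteq> S \<Longrightarrow> insert v S \<in> K"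
    and L: "L = {S \<in> K. \<not> \<sigma> \<subseteq> S}"
  shows "geom_realization V K homotopy_equivalent_space geom_realization V L"
proof (cases "\<exists>S\<in>K. \<sigma> \<subseteq> S")
  case False
  then have "L = K" using L by auto
  then show ?thesis
    by (simp add: homotopy_equivalent_space_refl)
next
  case True
  then obtain S0 where S0: "S0 \<in> K" "\<sigma> \<subseteq> S0" by auto
  have fin: "finite \<sigma>" "\<sigma> \<subseteq> V" and vV: "v \<in> V"
    using S0(2) simplicialD(3,4)[OF K S0(1)] simplicialD(3)[OF K cone[OF S0]] finite_subset by auto
  define m where "m f = Min (f ` \<sigma>)" for f :: "'a \<Rightarrow> real"
  define r where "r f = (\<lambda>w. f w - m f * of_bool (w \<in> \<sigma>) + m f * card \<sigma> * of_bool (w = v))" for f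
  let ?X = "geom_realization V K" and ?Y = "geom_realization V L"
  have LK: "points V L \<subseteq> points V K" using L by (auto simp: points_def)
  have m0: "0 \<le> m f" and mle: "\<And>w. w \<in> \<sigma> \<Longrightarrow> m f \<le> f w" and mpos: "m f \<noteq> 0 \<Longrightarrow> \<sigma> \<subseteq> {w. f w \<noteq> 0}"
    if f: "f \<in> points V K" for f
  proof -
    show "0 \<le> m f" "\<And>w. w \<in> \<sigma> \<Longrightarrow> m f \<le> f w"
      using fin \<sigma> pointsD(1)[OF f] by (auto simp: m_def)
    then show "m f \<noteq> 0 \<Longrightarrow> \<sigma> \<subseteq> {w. f w \<noteq> 0}"
      by fastforce
  qed
  have rid: "r f = f" if "m f = 0" for f
    using that by (simp add: r_def)
  have mL: "m f = 0" if "f \<in> points V L" for f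
    using mpos[of f] that LK pointsD(4)[OF that] L by auto
  have rL: "r f \<in> points V L" if f: "f \<in> points V K" for f
  proof -
    have S: "{w. f w \<noteq> 0} \<in> K" using pointsD(4)[OF f] .
    have sm: "sum (r f) V = 1"
    proof -
      have "(\<Sum>w\<in>V. m f * of_bool (w \<in> \<sigma>)) = m f * card \<sigma>"
        using fin simplicialD(1)[OF K] by (simp add: Int_absorb1 flip: sum_distrib_left)
      moreover have "(\<Sum>w\<in>V. m f * card \<sigma> * of_bool (w = v)) = m f * card \<sigma>"
        using vV simplicialD(1)[OF K] by (simp flip: sum_distrib_left)
      ultimately show ?thesis
        using pointsD(3)[OF f] by (simp add: r_def sum.distrib sum_subtractf)
    qed
    have nn: "0 \<le> r f w" for w
      using m0[OF f] mle[OF f, of w] pointsD(1)[OF f, of w] by (auto simp: r_def)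
    have "r f \<in> points V K"
    proof (cases "m f = 0")
      case True then show ?thesis using rid f by simp
    next
      case False
      show ?thesis
        by (rule pointsI[OF K nn cone[OF S mpos[OF f False]] _ sm])
          (use mpos[OF f False] in \<open>auto simp: r_def\<close>)
    qed
    moreover have "\<not> \<sigma> \<subseteq> {w. r f w \<noteq> 0}"
    proof -
      have "m f \<in> f ` \<sigma>" using fin \<sigma> unfolding m_def by (intro Min_in) auto
      then obtain w where "w \<in> \<sigma>" "f w = m f" by auto
      moreover from this v have "r f w = 0" by (auto simp: r_def)
      ultimately show ?thesis by auto
    qed
    ultimately show ?thesis
      by (auto simp: points_def L)
  qed
  have cm: "continuous_map ?X euclideanreal m"
    unfolding m_def by (rule continuous_map_real_Min)
      (use fin \<sigma> in \<open>auto intro: continuous_map_geom_projection\<close>)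
  have cr: "continuous_map ?X ?Y r"
    unfolding continuous_map_into_geom_realization
  proof (intro conjI allI)
    show "continuous_map ?X euclideanreal (\<lambda>f. r f w)" for w
      unfolding r_def
      by (intro continuous_intros cm continuous_map_geom_projection)
  qed (use rL in auto)
  have ci: "continuous_map ?Y ?X id"
    using LK by (auto simp: continuous_map_into_geom_realization intro: continuous_map_geom_projection)
  have "homotopic_with (\<lambda>_. True) ?X ?X (id \<circ> r) id"
  proof (rule homotopic_contiguous[OF K continuous_map_compose[OF cr ci] continuous_map_id])
    fix f assume "f \<in> topspace ?X"
    then have f: "f \<in> points V K" by simp
    show "{w. (id \<circ> r) f w \<noteq> 0} \<union> {w. id f w \<noteq> 0} \<in> K"
    proof (cases "m f = 0")
      case True then show ?thesis using rid[OF True] pointsD(4)[OF f] by simp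
    next
      case False
      have "insert v {w. f w \<noteq> 0} \<in> K" by (rule cone[OF pointsD(4)[OF f] mpos[OF f False]])
      moreover have "{w. (id \<circ> r) f w \<noteq> 0} \<union> {w. id f w \<noteq> 0} \<subseteq> insert v {w. f w \<noteq> 0}"
        using mpos[OF f False] by (auto simp: r_def)
      moreover have "{w. (id \<circ> r) f w \<noteq> 0} \<union> {w. id f w \<noteq> 0} \<noteq> {}"
        using mpos[OF f False] \<sigma> by auto
      ultimately show ?thesis
        using simplicialD(5)[OF K, of "insert v {w. f w \<noteq> 0}"] by simp
    qed
  qed
  moreover have "homotopic_with (\<lambda>_. True) ?Y ?Y (r \<circ> id) id"
    using rid[OF mL] continuous_map_compose[OF ci cr]
    by (intro homotopic_with_equal) simp_all
  ultimately show ?thesis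
    unfolding homotopy_equivalent_space_def using cr ci by (intro exI conjI)
qed

subsection \<open>Removing facets with a contractible complement\<close>

text \<open>The standard argument that collapsing a contractible subspace is a homotopy equivalence,
  reduced to the data it uses. The homotopy \<open>h\<close> respects the fibres of \<open>q\<close>
  at all times and is constant on each of them at time 1. Its end therefore factors through
  \<open>q\<close>, which gives the inverse \<open>g\<close>, and \<open>q \<circ> h\<close>
  descends to the homotopy on \<open>W\<close>.\<close>

lemma homotopy_equivalent_quotient:
  assumes X: "compact_space X" and W: "Hausdorff_space W"
    and q: "continuous_map X W q" and surj: "q ` topspace X = topspace W"
    and h: "continuous_map (prod_topology (top_of_set {0..1::real}) X) X h"
    and h0: "\<And>x. x \<in> topspace X \<Longrightarrow> h (0, x) = x"
    and h1: "\<And>x y. x \<in> topspace X \<Longrightarrow> y \<in> topspace X \<Longrightarrow> q x = q y \<Longrightarrow> h (1, x) = h (1, y)"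
    and qh: "\<And>t x y. t \<in> {0..1} \<Longrightarrow> x \<in> topspace X \<Longrightarrow> y \<in> topspace X \<Longrightarrow> q x = q y \<Longrightarrow> q (h (t, x)) = q (h (t, y))"
  shows "X homotopy_equivalent_space W"
proof -
  let ?I = "top_of_set {0..1::real}"
  \<comment> \<open>Only a set-theoretic section; the continuity of \<open>g\<close> and
    \<open>k\<close> comes from the quotient maps.\<close>
  define s where "s = inv_into (topspace X) q"
  have s: "s w \<in> topspace X" "q (s w) = w" if "w \<in> topspace W" for w
    using inv_into_into[of w q "topspace X"] f_inv_into_f[of w q "topspace X"] that surj
    by (simp_all add: s_def)
  have qW: "q x \<in> topspace W" if "x \<in> topspace X" for x
    using that surj by auto
  have quo: "quotient_map X W q"
    by (intro continuous_closed_imp_quotient_map continuous_imp_closed_map_gen X q surj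
        Hausdorff_imp_kc_space W)
  have h1c: "continuous_map X X (\<lambda>x. h (1, x))"
    by (rule continuous_map_compose[OF _ h, unfolded o_def]) (auto intro!: continuous_map_pairedI)
  define g where "g w = h (1, s w)" for w
  have g: "continuous_map W X g"
  proof (rule continuous_compose_quotient_map[OF quo])
    show "continuous_map X X (g \<circ> q)"
    proof (rule continuous_map_eq[OF h1c])
      show "h (1, x) = (g \<circ> q) x" if "x \<in> topspace X" for x
        using h1[OF that s(1)[OF qW[OF that]]] s(2)[OF qW[OF that]] by (simp add: g_def)
    qed
  qed
  have "homotopic_with (\<lambda>_. True) X X id (g \<circ> q)"
  proof (subst homotopic_with, simp, intro exI[of _ h] conjI ballI)
    show "h (1, x) = (g \<circ> q) x" if "x \<in> topspace X" for x
      using h1[OF that s(1)[OF qW[OF that]]] s(2)[OF qW[OF that]] by (simp add: g_def)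
  qed (use h h0 in auto)
  then have 1: "homotopic_with (\<lambda>_. True) X X (g \<circ> q) id"
    by (rule homotopic_with_symD)
  let ?iq = "\<lambda>(t::real, x). (t, q x)"
  have iqc: "continuous_map (prod_topology ?I X) (prod_topology ?I W) ?iq"
    using continuous_map_fst[of ?I X] continuous_map_compose[OF continuous_map_snd q, of ?I]
    by (simp add: continuous_map_pairwise case_prod_beta o_def)
  \<comment> \<open>A product of a quotient map with the interval is handled like \<open>q\<close>
    itself: source compact, target Hausdorff, hence closed.\<close>
  have quo2: "quotient_map (prod_topology ?I X) (prod_topology ?I W) ?iq"
  proof (intro continuous_closed_imp_quotient_map continuous_imp_closed_map_gen iqc Hausdorff_imp_kc_space)
    show "compact_space (prod_topology ?I X)"
      using X by (simp add: compact_space_prod_topology compact_space_subtopology)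
    show "Hausdorff_space (prod_topology ?I W)"
      using W by (simp add: Hausdorff_space_prod_topology Hausdorff_space_subtopology)
    show "?iq ` topspace (prod_topology ?I X) = topspace (prod_topology ?I W)"
      using surj by (force simp: image_iff)
  qed
  define k where "k = (\<lambda>(t::real, w). q (h (t, s w)))"
  have k: "continuous_map (prod_topology ?I W) W k"
  proof (rule continuous_compose_quotient_map[OF quo2])
    show "continuous_map (prod_topology ?I X) W (k \<circ> ?iq)"
    proof (rule continuous_map_eq[OF continuous_map_compose[OF h q]])
      fix z assume "z \<in> topspace (prod_topology ?I X)"
      then obtain t x where z: "z = (t, x)" "t \<in> {0..1}" "x \<in> topspace X" by auto
      have "q (h (t, x)) = q (h (t, s (q x)))"
        using z(2,3) s(1)[OF qW[OF z(3)]] s(2)[OF qW[OF z(3)]] by (intro qh) simp_all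
      then show "(q \<circ> h) z = (k \<circ> ?iq) z"
        by (simp add: z(1) k_def)
    qed
  qed
  have "homotopic_with (\<lambda>_. True) W W id (q \<circ> g)"
  proof (subst homotopic_with, simp, intro exI[of _ k] conjI ballI)
    show "k (0, w) = id w" if "w \<in> topspace W" for w
      using s[OF that] h0 by (simp add: k_def)
  qed (use k in \<open>simp_all add: k_def g_def\<close>)
  then have "homotopic_with (\<lambda>_. True) W W (q \<circ> g) id"
    by (rule homotopic_with_symD)
  with 1 show ?thesis
    unfolding homotopy_equivalent_space_def using q g by (intro exI conjI)
qed

text \<open>Expanding the unit sphere around the first basis vector gives
  \<open>|x|^2 = 2 x_0\<close>, the form produced by the inversion
  \<open>z \<mapsto> 2 z / |z|^2\<close> of the hyperplane \<open>z_0 = 1\<close>. The block of a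
  coordinate is its quotient by \<open>Suc d\<close>.\<close>

lemma block_sphere_iff:
  "x \<in> block_sphere d i \<longleftrightarrow>
     (\<forall>l. l div Suc d \<noteq> i \<longrightarrow> x l = 0) \<and> (\<Sum>j\<le>d. (x (i * Suc d + j))\<^sup>2) = 2 * x (i * Suc d)"
proof -
  have mem: "l \<in> {i * Suc d..<(i + 1) * Suc d} \<longleftrightarrow> l div Suc d = i" for l
  proof
    assume "l \<in> {i * Suc d..<(i + 1) * Suc d}"
    then show "l div Suc d = i" by (intro div_nat_eqI) (auto simp: mult.commute)
  next
    assume "l div Suc d = i"
    then show "l \<in> {i * Suc d..<(i + 1) * Suc d}"
      using div_mult_mod_eq[of l "Suc d"] mod_less_divisor[of "Suc d" l] by (auto simp del: mod_less_divisor)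
  qed
  have "(\<Sum>l\<in>{i * Suc d..<(i + 1) * Suc d}. (x l - (if l = i * Suc d then 1 else 0))\<^sup>2)
      = (\<Sum>j\<le>d. (x (i * Suc d + j) - (if j = 0 then 1 else 0))\<^sup>2)"
    by (rule sum.reindex_bij_witness[of _ "\<lambda>j. i * Suc d + j" "\<lambda>l. l - i * Suc d"]) auto
  also have "\<dots> = (\<Sum>j\<le>d. (x (i * Suc d + j))\<^sup>2) + (\<Sum>j\<le>d. if j = 0 then 1 - 2 * x (i * Suc d) else 0)"
    unfolding sum.distrib[symmetric] by (rule sum.cong) (auto simp: power2_diff)
  also have "\<dots> = (\<Sum>j\<le>d. (x (i * Suc d + j))\<^sup>2) + 1 - 2 * x (i * Suc d)"
    by simp
  finally have eq: "(\<Sum>l\<in>{i * Suc d..<(i + 1) * Suc d}. (x l - (if l = i * Suc d then 1 else 0))\<^sup>2)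
      = (\<Sum>j\<le>d. (x (i * Suc d + j))\<^sup>2) + 1 - 2 * x (i * Suc d)" .
  have "x \<in> block_sphere d i \<longleftrightarrow> (\<forall>l. l \<notin> {i * Suc d..<(i + 1) * Suc d} \<longrightarrow> x l = 0) \<and>
      (\<Sum>l\<in>{i * Suc d..<(i + 1) * Suc d}. (x l - (if l = i * Suc d then 1 else 0))\<^sup>2) = 1"
    by (simp only: block_sphere_def mem_Collect_eq Suc_eq_plus1)
  then show ?thesis
    unfolding eq mem by auto
qed

section \<open>Homotopy extension for the complement of a set of facets\<close>

locale facet_complex =
  fixes V :: "'a set" and K \<F> :: "'a set set" and d :: nat
  assumes K: "simplicial V K"
    and facets_sub: "\<F> \<subseteq> K"
    and facet_max: "\<And>F S. F \<in> \<F> \<Longrightarrow> S \<in> K \<Longrightarrow> F \<subseteq> S \<Longrightarrow> S = F"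
    and facet_card: "\<And>F. F \<in> \<F> \<Longrightarrow> card F = Suc d"
begin

definition A :: "'a set set" where "A = K - \<F>"

text \<open>The depth of a point inside the facet: on the realization it is positive exactly on the
  open simplex of \<open>F\<close>.\<close>

definition m :: "'a set \<Rightarrow> ('a \<Rightarrow> real) \<Rightarrow> real" where "m F f = Min (f ` F)"

lemma finite_facets: "finite \<F>"
  using simplicial_finite[OF K] facets_sub finite_subset by auto

lemma facetD:
  assumes "F \<in> \<F>"
  shows "finite F" "F \<noteq> {}" "F \<subseteq> V" "F \<in> K"
  using simplicialD(2-4)[OF K, of F] assms facets_sub by auto

lemma simplicial_A: "simplicial V A"
proof -
  have "A = {S \<in> K. S \<notin> \<F>}" by (auto simp: A_def)
  also have "simplicial V \<dots>"
    by (rule simplicial_filter[OF K]) (use facet_max in auto)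
  finally show ?thesis .
qed

lemma points_A_sub: "points V A \<subseteq> points V K"
  by (auto simp: points_def A_def)

lemma m_attained: "F \<in> \<F> \<Longrightarrow> \<exists>v\<in>F. m F f = f v"
  using Min_in[of "f ` F"] facetD(1,2)[of F] unfolding m_def by blast

lemma m_le: "F \<in> \<F> \<Longrightarrow> v \<in> F \<Longrightarrow> m F f \<le> f v"
  using facetD(1)[of F] by (simp add: m_def)

lemma m_nonneg: "f \<in> points V K \<Longrightarrow> F \<in> \<F> \<Longrightarrow> 0 \<le> m F f"
  using m_attained[of F f] pointsD(1)[of f V K] by auto

lemma m_zero_iff:
  assumes f: "f \<in> points V K" and F: "F \<in> \<F>"
  shows "m F f = 0 \<longleftrightarrow> {v. f v \<noteq> 0} \<noteq> F"
proof
  assume "m F f = 0"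
  then show "{v. f v \<noteq> 0} \<noteq> F" using m_attained[OF F, of f] by auto
next
  assume ne: "{v. f v \<noteq> 0} \<noteq> F"
  have "\<not> F \<subseteq> {v. f v \<noteq> 0}"
    using facet_max[OF F pointsD(4)[OF f]] ne by blast
  then obtain v where "v \<in> F" "f v = 0" by auto
  then show "m F f = 0"
    using m_le[OF F, of v f] m_nonneg[OF f F] by simp
qed

lemma points_A_iff: "f \<in> points V A \<longleftrightarrow> f \<in> points V K \<and> (\<forall>F\<in>\<F>. m F f = 0)"
proof
  assume f: "f \<in> points V A"
  then have "f \<in> points V K" using points_A_sub by auto
  moreover have "{v. f v \<noteq> 0} \<notin> \<F>" using pointsD(4)[OF f] by (simp add: A_def)
  ultimately show "f \<in> points V K \<and> (\<forall>F\<in>\<F>. m F f = 0)"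
    using m_zero_iff by auto
next
  assume f: "f \<in> points V K \<and> (\<forall>F\<in>\<F>. m F f = 0)"
  then have "{v. f v \<noteq> 0} \<notin> \<F>" using m_zero_iff by auto
  then show "f \<in> points V A" using f by (auto simp: A_def points_def)
qed

text \<open>Maximality makes the open facets pairwise disjoint, so at most one depth is nonzero.
  Sums over all facets, as in \<open>M\<close> and \<open>push\<close>, thus have at most one
  nonzero term, while their continuity is evident.\<close>

lemma point_cases:
  assumes f: "f \<in> points V K"
  obtains "f \<in> points V A"
  | F where "F \<in> \<F>" "{v. f v \<noteq> 0} = F" "0 < m F f" "\<And>F'. F' \<in> \<F> \<Longrightarrow> F' \<noteq> F \<Longrightarrow> m F' f = 0"
proof (cases "f \<in> points V A")
  case False
  then obtain F where F: "F \<in> \<F>" "m F f \<noteq> 0" using f points_A_iff by auto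
  then have "0 < m F f" "{v. f v \<noteq> 0} = F"
    using m_nonneg[OF f] m_zero_iff[OF f] by force+
  moreover from this have "\<And>F'. F' \<in> \<F> \<Longrightarrow> F' \<noteq> F \<Longrightarrow> m F' f = 0"
    using m_zero_iff[OF f] by auto
  ultimately show thesis using that(2) F(1) by blast
qed (use that in auto)

lemma continuous_m:
  assumes "F \<in> \<F>" "\<And>v. continuous_map X euclideanreal (\<lambda>x. g x v)"
  shows "continuous_map X euclideanreal (\<lambda>x. m F (g x))"
  unfolding m_def by (rule continuous_map_real_Min) (use facetD(1,2)[OF assms(1)] assms(2) in auto)

definition M :: "('a \<Rightarrow> real) \<Rightarrow> real" where "M f = (\<Sum>F\<in>\<F>. m F f)"

text \<open>
  Radial push towards the boundary of the facet carrying \<open>f\<close>: mass up to \<open>T\<close> is removed from each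
  of its vertices. This is the first half of the homotopy extension, the second half being the
  contraction of \<^const>\<open>A\<close>.
\<close>

definition push :: "real \<Rightarrow> ('a \<Rightarrow> real) \<Rightarrow> 'a \<Rightarrow> real" where
  "push T f v = (f v - (\<Sum>F\<in>\<F>. min (m F f) T * of_bool (v \<in> F))) / (1 - Suc d * (\<Sum>F\<in>\<F>. min (m F f) T))"

lemma push_A:
  assumes "f \<in> points V A" "0 \<le> T"
  shows "push T f = f" "M f = 0" "(\<Sum>F\<in>\<F>. min (m F f) T) = 0"
  using assms points_A_iff[of f] by (auto simp: push_def M_def)

lemma push_facet:
  assumes F: "F \<in> \<F>" and z: "\<And>F'. F' \<in> \<F> \<Longrightarrow> F' \<noteq> F \<Longrightarrow> m F' f = 0" and "0 \<le> T"
  shows "push T f v = (f v - min (m F f) T * of_bool (v \<in> F)) / (1 - Suc d * min (m F f) T)"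
    and "M f = m F f" and "(\<Sum>F\<in>\<F>. min (m F f) T) = min (m F f) T"
proof -
  have eq: "(\<Sum>F'\<in>\<F>. g F') = g F" if "\<And>F'. F' \<in> \<F> \<Longrightarrow> F' \<noteq> F \<Longrightarrow> g F' = 0" for g :: "'a set \<Rightarrow> real"
    using that F finite_facets by (subst sum.remove[of _ F]) auto
  show M: "M f = m F f" unfolding M_def by (rule eq) (use z in auto)
  show c: "(\<Sum>F\<in>\<F>. min (m F f) T) = min (m F f) T"
    by (rule eq) (use z \<open>0 \<le> T\<close> in auto)
  have "(\<Sum>F\<in>\<F>. min (m F f) T * of_bool (v \<in> F)) = min (m F f) T * of_bool (v \<in> F)"
    by (rule eq) (use z \<open>0 \<le> T\<close> in auto)
  then show "push T f v = (f v - min (m F f) T * of_bool (v \<in> F)) / (1 - Suc d * min (m F f) T)"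
    by (simp add: push_def c)
qed

text \<open>At the barycentre of a facet the depth is \<open>1 / (d + 1)\<close>, and removing all
  of it would leave no mass to normalize. The bound on \<open>T\<close> stops the push when at most
  half of the mass is gone.\<close>

lemma push_denominator:
  fixes T :: real
  assumes f: "f \<in> points V K" and T: "0 \<le> T" "2 * Suc d * T \<le> 1"
  shows "1 - Suc d * (\<Sum>F\<in>\<F>. min (m F f) T) > 0"
  using f
proof (cases rule: point_cases)
  case 1
  then show ?thesis using push_A(3)[OF 1 T(1)] by simp
next
  case (2 F)
  have "Suc d * min (m F f) T \<le> Suc d * T"
    by (intro mult_left_mono) auto
  moreover have "2 * (Suc d * T) \<le> 1"
    using T(2) by (simp only: mult.assoc)
  ultimately have "Suc d * min (m F f) T < 1"
    by linarith
  then show ?thesis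
    using push_facet(3)[OF 2(1,4) T(1)] by simp
qed

lemma push_zero: "f \<in> points V K \<Longrightarrow> push 0 f = f"
  using m_nonneg[of f] by (simp add: push_def fun_eq_iff min_absorb2)

lemma push_points:
  fixes T :: real
  assumes f: "f \<in> points V K" and T: "0 \<le> T" "2 * Suc d * T \<le> 1"
  shows "push T f \<in> points V K \<and> (M f \<le> T \<longrightarrow> push T f \<in> points V A)"
  using f
proof (cases rule: point_cases)
  case 1
  then show ?thesis
    using f push_A(1)[OF 1 T(1)] by auto
next
  case (2 F)
  note eq = push_facet[OF 2(1,4) T(1)]
  have den: "1 - Suc d * min (m F f) T > 0"
    using push_denominator[OF f T] eq(3) by simp
  have zero: "push T f v = 0" if "v \<notin> F" for v
    using that 2(2) by (auto simp: eq(1))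
  have PK: "push T f \<in> points V K"
  proof (rule pointsI[OF K _ facetD(4)[OF 2(1)]])
    show "0 \<le> push T f v" for v
      using den m_le[OF 2(1), of v f] pointsD(1)[OF f, of v] by (auto simp: eq(1))
    have "(\<Sum>v\<in>V. min (m F f) T * of_bool (v \<in> F)) = min (m F f) T * card F"
      using facetD(3)[OF 2(1)] simplicialD(1)[OF K] by (simp add: Int_absorb1 flip: sum_distrib_left)
    then have "sum (push T f) V = (1 - min (m F f) T * card F) / (1 - Suc d * min (m F f) T)"
      using pointsD(3)[OF f] by (simp add: eq(1) sum_subtractf flip: sum_divide_distrib)
    then show "sum (push T f) V = 1"
      using den facet_card[OF 2(1)] by (simp add: mult.commute)
  qed (use zero in auto)
  have "push T f \<in> points V A" if "M f \<le> T"
  proof -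
    obtain v where v: "v \<in> F" "m F f = f v" using m_attained[OF 2(1)] by auto
    then have "push T f v = 0" using that by (simp add: eq)
    then have "{v. push T f v \<noteq> 0} \<noteq> F'" if "F' \<in> \<F>" for F'
      using v(1) zero facet_max[OF that facetD(4)[OF 2(1)]] by blast
    then show ?thesis using PK m_zero_iff[OF PK] points_A_iff by auto
  qed
  with PK show ?thesis by simp
qed

text \<open>A point of depth \<open>M f\<close> is pushed until time \<open>2 (d + 1) M f\<close>,
  when it arrives in \<open>A\<close>; from then on it follows the contraction \<open>H\<close>,
  started at that moment, with \<open>\<tau>\<close> as the elapsed time. Points that are too deep
  do not arrive before time 1 and are only pushed. Points of \<open>A\<close> have depth 0 and
  follow \<open>H\<close> from the beginning.\<close>

lemma homotopy_contracting_A: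
  assumes "contractible_space (geom_realization V A)"
  obtains h a where "continuous_map (prod_topology (top_of_set {0..1::real}) (geom_realization V K)) (geom_realization V K) h"
    and "\<And>f. f \<in> points V K \<Longrightarrow> h (0, f) = f"
    and "\<And>t f. t \<in> {0..1} \<Longrightarrow> f \<in> points V A \<Longrightarrow> h (t, f) \<in> points V A"
    and "\<And>f. f \<in> points V A \<Longrightarrow> h (1, f) = a"
proof -
  let ?I = "top_of_set {0..1::real}" and ?X = "geom_realization V K" and ?A = "geom_realization V A"
  obtain H a where H: "continuous_map (prod_topology ?I ?A) ?A H"
    and H0: "\<And>f. H (0, f) = f" and H1: "\<And>f. H (1, f) = a"
    using assms unfolding contractible_space_def homotopic_with_def by auto
  let ?Z = "prod_topology ?I ?X"
  \<comment> \<open>The speed is chosen so that \<open>T 1\<close> is the largest value that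
    \<open>push_denominator\<close> admits.\<close>
  define T where "T = (\<lambda>t::real. t / (2 * Suc d))"
  define P where "P z = push (T (fst z)) (snd z)" for z
  define \<tau> where "\<tau> z = fst z - 2 * Suc d * M (snd z)" for z
  define h where "h = (\<lambda>z. if T (fst z) \<le> M (snd z) then P z else H (\<tau> z, P z))"
  have T: "0 \<le> T t" "2 * Suc d * T t \<le> 1" if "t \<in> {0..1}" for t
    using that by (auto simp: T_def)
  have M0: "0 \<le> M f" if "f \<in> points V K" for f
    unfolding M_def by (intro sum_nonneg m_nonneg that)
  have fst: "continuous_map ?Z euclideanreal fst"
    using continuous_map_fst continuous_map_in_subtopology by blast
  have snd: "continuous_map ?Z euclideanreal (\<lambda>z. snd z v)" for v
    by (rule continuous_map_coordinate[OF continuous_map_snd])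
  have cm: "continuous_map ?Z euclideanreal (\<lambda>z. m F (snd z))" if "F \<in> \<F>" for F
    by (rule continuous_m[OF that snd])
  have cM: "continuous_map ?Z euclideanreal (\<lambda>z. M (snd z))"
    unfolding M_def by (intro continuous_map_sum finite_facets cm)
  have cT: "continuous_map ?Z euclideanreal (\<lambda>z. T (fst z))"
    unfolding T_def by (intro continuous_intros fst) simp
  have cP: "continuous_map ?Z ?X P"
    unfolding continuous_map_into_geom_realization
  proof (intro conjI allI)
    show "continuous_map ?Z euclideanreal (\<lambda>z. P z v)" for v
      unfolding P_def push_def
    proof (intro continuous_intros finite_facets snd cm cT)
      fix z assume "z \<in> topspace ?Z"
      then show "1 - Suc d * (\<Sum>F\<in>\<F>. min (m F (snd z)) (T (fst z))) \<noteq> 0"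
        using push_denominator[OF _ T, of "snd z" "fst z"] by (auto simp: mem_Times_iff)
    qed simp_all
    show "P \<in> topspace ?Z \<rightarrow> points V K"
      using push_points[OF _ T] by (auto simp: P_def)
  qed
  have inA: "\<tau> z \<in> {0..1}" "P z \<in> points V A" if "z \<in> topspace ?Z" "M (snd z) \<le> T (fst z)" for z
  proof -
    have "2 * Suc d * M (snd z) \<le> fst z"
      using that(2) by (simp add: T_def field_simps)
    moreover have "0 \<le> 2 * Suc d * M (snd z)"
      using that(1) M0[of "snd z"] by (intro mult_nonneg_nonneg) (auto simp: mem_Times_iff)
    ultimately show "\<tau> z \<in> {0..1}"
      using that(1) unfolding \<tau>_def by (auto simp: mem_Times_iff simp del: of_nat_Suc)
    show "P z \<in> points V A"
      using push_points[OF _ T, of "snd z" "fst z"] that by (auto simp: P_def mem_Times_iff)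
  qed
  have "continuous_map ?Z ?X h"
    unfolding h_def
  proof (rule continuous_map_cases_le[OF cT cM])
    show "continuous_map (subtopology ?Z {z \<in> topspace ?Z. T (fst z) \<le> M (snd z)}) ?X P"
      by (rule continuous_map_from_subtopology[OF cP])
    let ?S = "subtopology ?Z {z \<in> topspace ?Z. M (snd z) \<le> T (fst z)}"
    have "continuous_map ?S (prod_topology ?I ?A) (\<lambda>z. (\<tau> z, P z))"
    proof (rule continuous_map_pairedI)
      have "continuous_map ?Z euclideanreal \<tau>"
        unfolding \<tau>_def by (intro continuous_intros fst cM)
      then show "continuous_map ?S ?I \<tau>"
        using inA(1) by (auto simp: continuous_map_in_subtopology continuous_map_from_subtopology)
      show "continuous_map ?S ?A P"
        unfolding continuous_map_into_geom_realization
        using inA(2) continuous_map_coordinate[OF cP] by (auto intro: continuous_map_from_subtopology)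
    qed
    from continuous_map_compose[OF this H]
    show "continuous_map ?S ?X (\<lambda>z. H (\<tau> z, P z))"
      using points_A_sub unfolding continuous_map_into_geom_realization o_def by blast
  next
    fix z assume "z \<in> topspace ?Z" "T (fst z) = M (snd z)"
    then show "P z = H (\<tau> z, P z)"
      by (simp add: \<tau>_def T_def field_simps flip: H0)
  qed
  moreover have "h (0, f) = f" if "f \<in> points V K" for f
    using M0[OF that] push_zero[OF that] by (simp add: h_def T_def P_def)
  moreover have hA: "h (t, f) = H (t, f)" if "t \<in> {0..1}" "f \<in> points V A" for t f
    using push_A[OF that(2) T(1)[OF that(1)]] that(1) by (auto simp: h_def P_def \<tau>_def T_def H0 divide_le_0_iff)
  moreover have "h (t, f) \<in> points V A" if "t \<in> {0..1}" "f \<in> points V A" for t f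
    using hA[OF that] continuous_map_image_subset_topspace[OF H] that by auto
  moreover have "h (1, f) = a" if "f \<in> points V A" for f
    using hA[OF _ that] H1 by simp
  ultimately show thesis using that by blast
qed

end

section \<open>The explicit quotient map onto the wedge of spheres\<close>

locale enumerated_facets = facet_complex V K \<F> d
  for V :: "'a set" and K \<F> :: "'a set set" and d :: nat +
  fixes E :: "nat \<Rightarrow> 'a set" and u :: "nat \<Rightarrow> nat \<Rightarrow> 'a" and k :: nat
  assumes E: "bij_betw E {..<k} \<F>"
    and u: "\<And>i. i < k \<Longrightarrow> bij_betw (u i) {..d} (E i)"
    and k: "0 < k"
begin

text \<open>
  Inside the facet \<open>E i\<close>, \<open>Z / m\<close> is a chart with values in the hyperplane of vectors whose coordinate
  0 is 1, and \<open>q\<close> is its inversion \<open>z \<mapsto> 2 z / |z|\<^sup>2\<close>, which maps that hyperplane onto the sphere minus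
  the origin. The last summand of \<open>D\<close> vanishes on \<open>E i\<close> and keeps \<open>D\<close> positive elsewhere.
\<close>

definition Z :: "nat \<Rightarrow> ('a \<Rightarrow> real) \<Rightarrow> nat \<Rightarrow> real" where
  "Z i f j = (if j = 0 then m (E i) f else f (u i j) - f (u i 0))"

definition D :: "nat \<Rightarrow> ('a \<Rightarrow> real) \<Rightarrow> real" where
  "D i f = (\<Sum>j\<le>d. (Z i f j)\<^sup>2) + (1 - sum f (E i))\<^sup>2"

definition q :: "('a \<Rightarrow> real) \<Rightarrow> nat \<Rightarrow> real" where
  "q f l = (let i = l div Suc d in if i < k then 2 * m (E i) f * Z i f (l mod Suc d) / D i f else 0)"

lemma E_facet: "i < k \<Longrightarrow> E i \<in> \<F>"
  using E by (auto simp: bij_betw_def)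

lemma E_inj: "i < k \<Longrightarrow> i' < k \<Longrightarrow> E i = E i' \<Longrightarrow> i = i'"
  using E by (auto simp: bij_betw_def inj_on_def)

lemma u_mem: "i < k \<Longrightarrow> j \<le> d \<Longrightarrow> u i j \<in> E i"
  using u[of i] by (auto simp: bij_betw_def)

lemma u_surj: "i < k \<Longrightarrow> v \<in> E i \<Longrightarrow> \<exists>j\<le>d. u i j = v"
  using u[of i] by (force simp: bij_betw_def)

lemma q_block: "j \<le> d \<Longrightarrow> i < k \<Longrightarrow> q f (i * Suc d + j) = 2 * m (E i) f * Z i f j / D i f"
proof -
  assume "j \<le> d" "i < k"
  then have "(i * Suc d + j) div Suc d = i" "(i * Suc d + j) mod Suc d = j"
    unfolding div_mult_self3[OF nat.distinct(2)] mod_mult_self3 by simp_all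
  then show ?thesis using \<open>i < k\<close> by (simp only: q_def Let_def if_True)
qed

text \<open>Were \<open>D i f\<close> zero, all coordinates on \<open>E i\<close> would agree, hence
  equal their minimum, which is \<open>Z i f 0 = 0\<close>; but their sum would be 1. Positivity on
  the whole complex makes \<open>q\<close> continuous across the boundary of the facet, where the
  factor \<open>m (E i) f\<close> sends it to the origin.\<close>

lemma D_pos:
  assumes f: "f \<in> points V K" and i: "i < k"
  shows "0 < D i f"
proof -
  have "D i f \<noteq> 0"
  proof
    assume "D i f = 0"
    then have "(\<Sum>j\<le>d. (Z i f j)\<^sup>2) = 0" and s: "sum f (E i) = 1"
      using sum_nonneg[of "{..d}" "\<lambda>j. (Z i f j)\<^sup>2"] unfolding D_def
      by (simp_all add: add_nonneg_eq_0_iff)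
    then have Z0: "Z i f j = 0" if "j \<le> d" for j
      using that by (simp add: sum_nonneg_eq_0_iff)
    have "m (E i) f = 0" using Z0[of 0] by (simp add: Z_def)
    moreover have const: "f v = f (u i 0)" if "v \<in> E i" for v
    proof -
      obtain j where "j \<le> d" "u i j = v" using u_surj[OF i \<open>v \<in> E i\<close>] by auto
      then show ?thesis using Z0[of j] by (auto simp: Z_def split: if_splits)
    qed
    moreover obtain w where "w \<in> E i" "m (E i) f = f w"
      using m_attained[OF E_facet[OF i]] by auto
    ultimately have "f v = 0" if "v \<in> E i" for v using that by metis
    then show False using s by simp
  qed
  moreover have "0 \<le> D i f" unfolding D_def by (intro add_nonneg_nonneg sum_nonneg) auto
  ultimately show ?thesis by simp
qed

lemma q_A: "f \<in> points V A \<Longrightarrow> q f = (\<lambda>_. 0)"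
  using points_A_iff[of f] E_facet by (auto simp: q_def Let_def fun_eq_iff)

text \<open>On the open facet \<open>D\<close> is the squared norm of \<open>Z\<close>, so the
  squared norm of the block of \<open>q f\<close> is \<open>(2 m / D)^2 * D = 4 m^2 / D\<close>,
  which is twice its coordinate 0.\<close>

lemma q_facet:
  assumes f: "f \<in> points V K" and i: "i < k" and supp: "{v. f v \<noteq> 0} = E i"
  shows "q f \<in> block_sphere d i" and "0 < q f (i * Suc d)"
proof -
  have sumE: "sum f (E i) = 1"
    using sum_over_face[OF K facetD(4)[OF E_facet[OF i]], of f] supp pointsD(3)[OF f] by auto
  have pos: "0 < m (E i) f"
    using m_zero_iff[OF f E_facet[OF i]] supp m_nonneg[OF f E_facet[OF i]] by linarith
  have q0: "q f (i * Suc d) = 2 * (m (E i) f)\<^sup>2 / D i f"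
    using q_block[of 0 i f] i by (simp add: Z_def power2_eq_square)
  then show "0 < q f (i * Suc d)"
    using pos D_pos[OF f i] by simp
  have "q f l = 0" if "l div Suc d \<noteq> i" for l
  proof (cases "l div Suc d < k")
    case True
    then have "m (E (l div Suc d)) f = 0"
      using m_zero_iff[OF f E_facet[OF True]] supp E_inj[OF True i] that by auto
    then show ?thesis by (simp add: q_def Let_def)
  qed (simp add: q_def)
  moreover have "(\<Sum>j\<le>d. (q f (i * Suc d + j))\<^sup>2) = 2 * q f (i * Suc d)"
  proof -
    have "(\<Sum>j\<le>d. (q f (i * Suc d + j))\<^sup>2) = (\<Sum>j\<le>d. (2 * m (E i) f / D i f)\<^sup>2 * (Z i f j)\<^sup>2)"
    proof (rule sum.cong)
      show "(q f (i * Suc d + j))\<^sup>2 = (2 * m (E i) f / D i f)\<^sup>2 * (Z i f j)\<^sup>2" if "j \<in> {..d}" for j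
        using q_block[of j i f] i that by (simp only: atMost_iff) (simp add: power_mult_distrib power_divide)
    qed simp
    also have "\<dots> = (2 * m (E i) f / D i f)\<^sup>2 * D i f"
      by (simp add: D_def sumE flip: sum_distrib_left)
    also have "\<dots> = 2 * q f (i * Suc d)"
      unfolding q0 using D_pos[OF f i] by (simp add: power2_eq_square)
    finally show ?thesis .
  qed
  ultimately show "q f \<in> block_sphere d i"
    unfolding block_sphere_iff by simp
qed

text \<open>A positive first coordinate in a block identifies the facet, and dividing the block by
  it undoes the inversion and recovers the chart \<open>Z / m\<close>. Equality of charts means that
  \<open>f\<close> and \<open>g\<close> are related by \<open>f = \<rho> g + \<kappa>\<close> on the
  facet. Comparing the two minima gives \<open>\<kappa> = 0\<close>, and comparing the sums gives
  \<open>\<rho> = 1\<close>.\<close>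

lemma q_inj:
  assumes f: "f \<in> points V K" "f \<notin> points V A" and g: "g \<in> points V K" and eq: "q f = q g"
  shows "f = g"
  using f(1)
proof (cases rule: point_cases)
  case (2 F)
  then obtain i where i: "i < k" "F = E i" using E by (auto simp: bij_betw_def)
  note suppf = 2(2)[unfolded i(2)]
  have mf: "0 < m (E i) f" using 2(3) i by simp
  have q0: "q g (i * Suc d) > 0" using q_facet(2)[OF f(1) i(1) suppf] eq by simp
  then have "m (E i) g \<noteq> 0" using q_block[of 0 i g] i(1) by auto
  then have suppg: "{v. g v \<noteq> 0} = E i" and mg: "0 < m (E i) g"
    using m_zero_iff[OF g E_facet[OF i(1)]] m_nonneg[OF g E_facet[OF i(1)]] by auto
  have sumE: "sum h (E i) = 1" if "h \<in> points V K" "{v. h v \<noteq> 0} = E i" for h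
    using sum_over_face[OF K facetD(4)[OF E_facet[OF i(1)]], of h] that pointsD(3)[of h V K] by auto
  have ratio: "Z i h j / m (E i) h = q h (i * Suc d + j) / q h (i * Suc d)"
    if "h \<in> points V K" "0 < m (E i) h" "j \<le> d" for h j
  proof -
    have "q h (i * Suc d) = 2 * m (E i) h * m (E i) h / D i h"
      using q_block[of 0 i h] i(1) by (simp add: Z_def)
    then show ?thesis
      using D_pos[OF that(1) i(1)] that(2) unfolding q_block[OF that(3) i(1)] by simp
  qed
  define \<rho> where "\<rho> = m (E i) f / m (E i) g"
  have \<rho>: "0 < \<rho>" using mf mg by (simp add: \<rho>_def)
  define \<kappa> where "\<kappa> = f (u i 0) - \<rho> * g (u i 0)"
  have lin: "f v = \<rho> * g v + \<kappa>" if v: "v \<in> E i" for v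
  proof -
    obtain j where j: "j \<le> d" "u i j = v" using u_surj[OF i(1) v] by auto
    show ?thesis
    proof (cases "j = 0")
      case True then show ?thesis using j by (simp add: \<kappa>_def)
    next
      case False
      have "Z i f j / m (E i) f = Z i g j / m (E i) g"
        unfolding ratio[OF f(1) mf j(1)] ratio[OF g mg j(1)] eq ..
      then have "f v - f (u i 0) = \<rho> * (g v - g (u i 0))"
        using False j mf mg by (simp add: Z_def \<rho>_def field_simps)
      then show ?thesis by (simp add: \<kappa>_def algebra_simps)
    qed
  qed
  note F = E_facet[OF i(1)]
  obtain v where v: "v \<in> E i" "m (E i) g = g v" using m_attained[OF F] by auto
  obtain w where w: "w \<in> E i" "m (E i) f = f w" using m_attained[OF F] by auto
  have mm: "\<rho> * m (E i) g = m (E i) f" using mg by (simp add: \<rho>_def)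
  have "m (E i) f \<le> m (E i) f + \<kappa>" using m_le[OF F v(1), of f] lin[OF v(1)] v(2) mm by simp
  moreover have "\<rho> * m (E i) g \<le> \<rho> * g w" using m_le[OF F w(1), of g] \<rho> by simp
  then have "m (E i) f + \<kappa> \<le> m (E i) f" using lin[OF w(1)] w(2) mm by simp
  ultimately have fg: "f v = \<rho> * g v" if "v \<in> E i" for v
    using lin[OF that] by simp
  have "sum f (E i) = \<rho> * sum g (E i)"
    by (simp add: fg sum_distrib_left)
  then have "\<rho> = 1" using sumE[OF f(1) suppf] sumE[OF g suppg] by simp
  show "f = g"
  proof
    fix v
    have "f v \<noteq> 0 \<longleftrightarrow> v \<in> E i" unfolding suppf[symmetric] by simp
    moreover have "g v \<noteq> 0 \<longleftrightarrow> v \<in> E i" unfolding suppg[symmetric] by simp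
    ultimately show "f v = g v"
      using fg[of v] \<open>\<rho> = 1\<close> by (cases "v \<in> E i") auto
  qed
qed (use f(2) in auto)

text \<open>The chart value determines the point up to scale: \<open>f / m\<close> has minimum 1 and
  prescribed differences \<open>z\<close>, so it must be \<open>y = 1 + z - \<mu>\<close> with
  \<open>\<mu>\<close> the least \<open>z\<close>. Normalizing by the sum \<open>N\<close> makes the
  depth \<open>1 / N\<close>.\<close>

lemma q_surj_facet:
  assumes i: "i < k" and x: "x \<in> block_sphere d i" and x0: "x (i * Suc d) \<noteq> 0"
  shows "\<exists>f\<in>points V K. q f = x"
proof -
  define X where "X j = x (i * Suc d + j)" for j
  have xz: "\<And>l. l div Suc d \<noteq> i \<Longrightarrow> x l = 0" and xs: "(\<Sum>j\<le>d. (X j)\<^sup>2) = 2 * X 0"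
    using x unfolding block_sphere_iff X_def by simp_all
  have X0: "0 < X 0" 
  proof -
    have "0 \<le> 2 * X 0" unfolding xs[symmetric] by (simp add: sum_nonneg)
    then show ?thesis using x0 by (simp add: X_def)
  qed
  \<comment> \<open>Coordinate 0 of the chart is constantly 1 and carries no information; here index
    0 stands for the difference \<open>f (u i 0) - f (u i 0)\<close> instead.\<close>
  define z where "z j = (if j = 0 then 0 else X j / X 0)" for j
  define \<mu> where "\<mu> = Min (z ` {..d})"
  define y where "y j = 1 + z j - \<mu>" for j
  have y1: "1 \<le> y j" if "j \<le> d" for j
  proof -
    have "\<mu> \<le> z j" unfolding \<mu>_def using that by (intro Min_le) auto
    then show ?thesis by (simp add: y_def)
  qed
  have "\<mu> \<in> z ` {..d}" unfolding \<mu>_def by (intro Min_in) auto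
  then obtain j0 where j0: "j0 \<le> d" "y j0 = 1" by (auto simp: y_def)
  define N where "N = (\<Sum>j\<le>d. y j)"
  have "y 0 \<le> N" unfolding N_def
    by (rule member_le_sum) (use y1 in \<open>auto intro: order_trans[OF zero_le_one]\<close>)
  then have N: "0 < N" using y1[of 0] by simp
  define f where "f v = (if v \<in> E i then y (inv_into {..d} (u i) v) / N else 0)" for v
  have fu: "f (u i j) = y j / N" if "j \<le> d" for j
    using that u_mem[OF i that] bij_betw_inv_into_left[OF u[OF i], of j] by (simp add: f_def)
  note F = E_facet[OF i]
  have nz: "0 < f v" if "v \<in> E i" for v
    using u_surj[OF i that] fu y1 N by (force intro: divide_pos_pos less_le_trans[OF zero_less_one])
  have supp: "{v. f v \<noteq> 0} = E i"
    using nz by (force simp: f_def)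
  have sumE: "sum f (E i) = 1"
  proof -
    have "sum f (E i) = (\<Sum>j\<le>d. f (u i j))"
      using sum.reindex_bij_betw[OF u[OF i], of f] by simp
    also have "\<dots> = 1" using N by (simp add: fu N_def flip: sum_divide_distrib)
    finally show ?thesis .
  qed
  have fK: "f \<in> points V K"
  proof (rule pointsI[OF K _ facetD(4)[OF F]])
    show "0 \<le> f v" for v using nz[of v] by (cases "v \<in> E i") (auto simp: f_def)
    show zero: "f v = 0" if "v \<notin> E i" for v using that by (simp add: f_def)
    show "sum f V = 1" using sum_over_face[OF K facetD(4)[OF F] zero] sumE by simp
  qed
  have mf: "m (E i) f = 1 / N"
  proof (rule antisym)
    show "m (E i) f \<le> 1 / N" using m_le[OF F u_mem[OF i j0(1)], of f] j0 fu by simp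
    obtain v where v: "v \<in> E i" "m (E i) f = f v" using m_attained[OF F] by auto
    then show "1 / N \<le> m (E i) f"
      using u_surj[OF i v(1)] fu y1 N by (auto simp: divide_right_mono)
  qed
  have Z: "Z i f j = X j / (X 0 * N)" if "j \<le> d" for j
  proof (cases "j = 0")
    case True then show ?thesis using X0 by (simp add: Z_def mf)
  next
    case False
    then have "Z i f j = z j / N"
      using that by (simp add: Z_def fu y_def z_def diff_divide_distrib add_divide_distrib)
    then show ?thesis using False by (simp add: z_def)
  qed
  have "D i f = (\<Sum>j\<le>d. (X j)\<^sup>2 / (X 0 * N)\<^sup>2)"
    by (simp add: D_def sumE Z power_divide)
  also have "\<dots> = 2 * X 0 / (X 0 * N)\<^sup>2"
    by (simp only: xs flip: sum_divide_distrib)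
  also have "\<dots> = 2 / (X 0 * N\<^sup>2)"
    using X0 N by (simp add: power2_eq_square)
  finally have D: "D i f = 2 / (X 0 * N\<^sup>2)" .
  have "q f l = x l" for l
  proof (cases "l div Suc d = i")
    case True
    define j where "j = l mod Suc d"
    have j: "j \<le> d" using mod_less_divisor[of "Suc d" l] by (simp add: j_def)
    have l: "l = i * Suc d + j" unfolding j_def True[symmetric] by (rule div_mult_mod_eq[symmetric])
    show ?thesis
      unfolding l q_block[OF j i] mf Z[OF j] D using X0 N by (simp add: X_def power2_eq_square field_simps)
  next
    case False
    have "q f l = 0"
    proof -
      have "q f \<in> block_sphere d i" by (rule q_facet(1)[OF fK i supp])
      then show ?thesis using False unfolding block_sphere_iff by simp
    qed
    then show ?thesis using xz[OF False] by simp
  qed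
  then show ?thesis using fK by (intro bexI[of _ f]) auto
qed

text \<open>By \<open>|x|^2 = 2 x_0\<close> a point of a block sphere whose first block coordinate
  vanishes is the origin. It is the image of any point of \<open>A\<close>, whence the assumption
  that there is one.\<close>

lemma q_range:
  assumes "points V A \<noteq> {}"
  shows "q ` points V K = (\<Union>i<k. block_sphere d i)"
proof (intro equalityI subsetI)
  fix x assume "x \<in> q ` points V K"
  then obtain f where f: "f \<in> points V K" "x = q f" by auto
  from f(1) show "x \<in> (\<Union>i<k. block_sphere d i)"
  proof (cases rule: point_cases)
    case 1
    then have "x \<in> block_sphere d 0" using q_A f(2) by (simp add: block_sphere_iff)
    then show ?thesis using k by auto
  next
    case (2 F)
    then obtain i where "i < k" "F = E i" using E by (auto simp: bij_betw_def)
    then show ?thesis using q_facet(1)[OF f(1), of i] 2(2) f(2) by auto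
  qed
next
  fix x assume "x \<in> (\<Union>i<k. block_sphere d i)"
  then obtain i where i: "i < k" "x \<in> block_sphere d i" by auto
  show "x \<in> q ` points V K"
  proof (cases "x (i * Suc d) = 0")
    case True
    then have "(\<Sum>j\<le>d. (x (i * Suc d + j))\<^sup>2) = 0" and z: "\<And>l. l div Suc d \<noteq> i \<Longrightarrow> x l = 0"
      using i(2) unfolding block_sphere_iff by simp_all
    then have xj: "x (i * Suc d + j) = 0" if "j \<le> d" for j
      using that by (simp add: sum_nonneg_eq_0_iff)
    have "x l = 0" for l
    proof (cases "l div Suc d = i")
      case True
      have "l mod Suc d \<le> d" using mod_less_divisor[of "Suc d" l] by simp
      from xj[OF this] show ?thesis unfolding True[symmetric] div_mult_mod_eq .
    qed (use z in auto)
    moreover obtain a where "a \<in> points V A" using assms by auto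
    ultimately have "x = q a" "a \<in> points V K" using q_A points_A_sub by auto
    then show ?thesis by auto
  next
    case False
    then show ?thesis using q_surj_facet[OF i] by auto
  qed
qed

lemma continuous_q: "continuous_map (geom_realization V K) (product_topology (\<lambda>_. euclideanreal) UNIV) q"
  unfolding continuous_map_componentwise_UNIV
proof
  fix l
  define i where "i = l div Suc d"
  let ?X = "geom_realization V K"
  show "continuous_map ?X euclideanreal (\<lambda>f. q f l)"
  proof (cases "i < k")
    case True
    have cm: "continuous_map ?X euclideanreal (\<lambda>f. m (E i) f)"
      by (rule continuous_m[OF E_facet[OF True] continuous_map_geom_projection])
    have cZ: "continuous_map ?X euclideanreal (\<lambda>f. Z i f j)" for j
      unfolding Z_def using cm
      by (cases "j = 0") (auto intro!: continuous_intros continuous_map_geom_projection)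
    have "continuous_map ?X euclideanreal (\<lambda>f. D i f)"
      unfolding D_def using facetD(1)[OF E_facet[OF True]]
      by (intro continuous_intros cZ continuous_map_geom_projection) auto
    then have "continuous_map ?X euclideanreal (\<lambda>f. 2 * m (E i) f * Z i f (l mod Suc d) / D i f)"
      using D_pos[OF _ True] by (intro continuous_intros cm cZ) (auto simp: less_le)
    then show ?thesis using True by (simp add: q_def Let_def i_def)
  qed (simp add: q_def i_def)
qed

lemma homotopy_equivalent_wedge_enum:
  assumes "contractible_space (geom_realization V A)" "points V A \<noteq> {}"
  shows "geom_realization V K homotopy_equivalent_space wedge_spheres k d"
proof -
  let ?X = "geom_realization V K"
  obtain h a where h: "continuous_map (prod_topology (top_of_set {0..1::real}) ?X) ?X h"
    and h0: "\<And>f. f \<in> points V K \<Longrightarrow> h (0, f) = f"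
    and hA: "\<And>t f. t \<in> {0..1} \<Longrightarrow> f \<in> points V A \<Longrightarrow> h (t, f) \<in> points V A"
    and h1: "\<And>f. f \<in> points V A \<Longrightarrow> h (1, f) = a"
    using homotopy_contracting_A[OF assms(1)] by blast
  \<comment> \<open>The fibres of \<open>q\<close> are \<open>A\<close> and single points.\<close>
  have fibre: "f = g \<or> (f \<in> points V A \<and> g \<in> points V A)"
    if "f \<in> points V K" "g \<in> points V K" "q f = q g" for f g
    using q_inj[of f g] q_inj[of g f] that by metis
  show ?thesis
  proof (rule homotopy_equivalent_quotient[OF compact_geom_realization[OF K] _ _ _ h])
    show "Hausdorff_space (wedge_spheres k d)"
      unfolding wedge_spheres_def by (rule Hausdorff_space_real_product)
    show "continuous_map ?X (wedge_spheres k d) q"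
      unfolding wedge_spheres_def continuous_map_in_subtopology
      using continuous_q q_range[OF assms(2)] by auto
    show "q ` topspace ?X = topspace (wedge_spheres k d)"
      using q_range[OF assms(2)] by (simp add: wedge_spheres_def)
    show "h (0, f) = f" if "f \<in> topspace ?X" for f
      using h0 that by simp
    show "h (1, f) = h (1, g)" if "f \<in> topspace ?X" "g \<in> topspace ?X" "q f = q g" for f g
      using fibre[of f g] h1[of f] h1[of g] that by auto
    show "q (h (t, f)) = q (h (t, g))"
      if "t \<in> {0..1}" "f \<in> topspace ?X" "g \<in> topspace ?X" "q f = q g" for t f g
      using fibre[of f g] q_A[OF hA[OF that(1)], of f] q_A[OF hA[OF that(1)], of g] that by auto
  qed
qed

end

theorem (in facet_complex) homotopy_equivalent_wedge:
  assumes "contractible_space (geom_realization V A)" "points V A \<noteq> {}" "\<F> \<noteq> {}"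
  shows "geom_realization V K homotopy_equivalent_space wedge_spheres (card \<F>) d"
proof -
  obtain E where E: "bij_betw E {..<card \<F>} \<F>"
    using ex_bij_betw_nat_finite[OF finite_facets] by (auto simp: lessThan_atLeast0)
  have "\<exists>w. bij_betw w {..d} (E i)" if "i < card \<F>" for i
  proof -
    have "E i \<in> \<F>" using E that by (auto simp: bij_betw_def)
    then show ?thesis
      using ex_bij_betw_nat_finite[OF facetD(1), of "E i"] facet_card[of "E i"]
      by (simp add: lessThan_Suc_atMost flip: lessThan_atLeast0)
  qed
  then obtain u where "\<And>i. i < card \<F> \<Longrightarrow> bij_betw (u i) {..d} (E i)" by metis
  then interpret enumerated_facets V K \<F> d E u "card \<F>"
    using E assms(3) finite_facets by unfold_locales (auto simp: card_gt_0_iff)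
  show ?thesis by (rule homotopy_equivalent_wedge_enum[OF assms(1,2)])
qed

subsection \<open>Sequences of collapses\<close>

text \<open>Coarser than elementary collapses along free faces: one step removes the whole open star
  of \<open>\<sigma>\<close>, whose link has to be a cone with apex \<open>v\<close>.\<close>

inductive collapses :: "'a set set \<Rightarrow> 'a set set \<Rightarrow> bool" (infix \<open>\<searrow>\<close> 50) where
  collapses_refl: "K \<searrow> K"
| collapses_snoc: "K \<searrow> L \<Longrightarrow> \<sigma> \<noteq> {} \<Longrightarrow> v \<notin> \<sigma> \<Longrightarrow> (\<And>S. S \<in> L \<Longrightarrow> \<sigma> \<subseteq> S \<Longrightarrow> insert v S \<in> L) \<Longrightarrow>
    K \<searrow> {S \<in> L. \<not> \<sigma> \<subseteq> S}"

lemma collapses_trans [trans]: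
  assumes "K \<searrow> L" "L \<searrow> N"
  shows "K \<searrow> N"
  using assms(2,1) by induction (auto intro: collapses_snoc)

lemma collapses_subset: "K \<searrow> L \<Longrightarrow> L \<subseteq> K"
  by (induction rule: collapses.induct) auto

lemma collapses_homotopy_equivalent:
  assumes "K \<searrow> L" "simplicial V K"
  shows "simplicial V L \<and> geom_realization V K homotopy_equivalent_space geom_realization V L"
  using assms
proof induction
  case (collapses_refl K)
  then show ?case by (simp add: homotopy_equivalent_space_refl)
next
  case (collapses_snoc K L \<sigma> v)
  then have L: "simplicial V L" "geom_realization V K homotopy_equivalent_space geom_realization V L"
    by auto
  have "simplicial V {S \<in> L. \<not> \<sigma> \<subseteq> S}"
    by (rule simplicial_filter[OF L(1)]) auto
  moreover have "geom_realization V L homotopy_equivalent_space geom_realization V {S \<in> L. \<not> \<sigma> \<subseteq> S}"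
    by (rule collapse_homotopy_equivalent[OF L(1) collapses_snoc.hyps(2-4) refl])
  ultimately show ?case
    using L(2) homotopy_eqv_trans by blast
qed

lemma collapses_step:
  assumes "\<sigma> \<noteq> {}" "v \<notin> \<sigma>" "\<And>S. S \<in> K \<Longrightarrow> \<sigma> \<subseteq> S \<Longrightarrow> insert v S \<in> K"
  shows "K \<searrow> {S \<in> K. \<not> \<sigma> \<subseteq> S}"
  by (rule collapses_snoc[OF collapses_refl assms])

lemma collapses_chain:
  fixes r :: nat
  assumes "\<And>i. i < r \<Longrightarrow> C i \<searrow> C (Suc i)"
  shows "C 0 \<searrow> C r"
  using assms
proof (induction r)
  case (Suc r)
  then show ?case by (meson collapses_trans lessI less_SucI)
qed (rule collapses_refl)

text \<open>The cone condition for \<open>\<sigma> j\<close> is required only of faces that survived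
  the earlier removals, and inserting the apex must not bring back a removed face.\<close>

lemma collapses_sequence:
  fixes r :: nat
  assumes "\<And>j. j < r \<Longrightarrow> \<sigma> j \<noteq> {} \<and> v j \<notin> \<sigma> j"
    and "\<And>j S. j < r \<Longrightarrow> S \<in> K \<Longrightarrow> \<sigma> j \<subseteq> S \<Longrightarrow> (\<And>i. i < j \<Longrightarrow> \<not> \<sigma> i \<subseteq> S) \<Longrightarrow>
      insert (v j) S \<in> K \<and> (\<forall>i<j. \<not> \<sigma> i \<subseteq> insert (v j) S)"
  shows "K \<searrow> {S \<in> K. \<forall>j<r. \<not> \<sigma> j \<subseteq> S}"
proof -
  define C where "C i = {S \<in> K. \<forall>j<i. \<not> \<sigma> j \<subseteq> S}" for i
  have "C 0 \<searrow> C r"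
  proof (rule collapses_chain)
    fix i assume i: "i < r"
    have "C (Suc i) = {S \<in> C i. \<not> \<sigma> i \<subseteq> S}"
      by (auto simp: C_def less_Suc_eq)
    also have "C i \<searrow> \<dots>"
    proof (rule collapses_step)
      show "insert (v i) S \<in> C i" if "S \<in> C i" "\<sigma> i \<subseteq> S" for S
        using assms(2)[OF i, of S] that by (simp add: C_def)
    qed (use assms(1)[OF i] in auto)
    finally show "C i \<searrow> C (Suc i)" .
  qed
  then show ?thesis by (simp add: C_def)
qed

text \<open>
  The vertex \<open>p (3 j + 3)\<close> is removed with apex \<open>p (3 j + 1)\<close>: of the neighbours of that apex on the
  path, \<open>p (3 j)\<close> is already gone and \<open>p (3 j + 2)\<close> is excluded by \<open>p (3 j + 3)\<close>.
\<close>

lemma collapses_fold: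
  fixes p :: "nat \<Rightarrow> 'a"
  assumes ins: "\<And>S j. S \<in> L \<Longrightarrow> B \<subseteq> S \<Longrightarrow> j < J \<Longrightarrow> p (3 * j + 3) \<in> S \<Longrightarrow> p (3 * j) \<notin> S \<Longrightarrow>
      insert (p (3 * j + 1)) S \<in> L"
    and start: "\<And>S. S \<in> L \<Longrightarrow> B \<subseteq> S \<Longrightarrow> p 0 \<notin> S"
    and B: "\<And>j. j < J \<Longrightarrow> p (3 * j + 1) \<notin> B"
    and dist: "\<And>i j. i < J \<Longrightarrow> j < J \<Longrightarrow> p (3 * i + 3) \<noteq> p (3 * j + 1)"
  shows "L \<searrow> {S \<in> L. B \<subseteq> S \<longrightarrow> (\<forall>j<J. p (3 * j + 3) \<notin> S)}"
proof -
  have "L \<searrow> {S \<in> L. \<forall>j<J. \<not> insert (p (3 * j + 3)) B \<subseteq> S}"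
  proof (rule collapses_sequence[where v = "\<lambda>j. p (3 * j + 1)"])
    fix j S assume j: "j < J" and S: "S \<in> L" "insert (p (3 * j + 3)) B \<subseteq> S"
      and prev: "\<And>i. i < j \<Longrightarrow> \<not> insert (p (3 * i + 3)) B \<subseteq> S"
    have "p (3 * j) \<notin> S"
    proof (cases j)
      case 0 then show ?thesis using start S by simp
    next
      case (Suc i)
      then have "3 * j = 3 * i + 3" by simp
      moreover have "p (3 * i + 3) \<notin> S" using prev[of i] S(2) Suc by auto
      ultimately show ?thesis by (simp only:) simp
    qed
    then have "insert (p (3 * j + 1)) S \<in> L" using S j by (intro ins) auto
    moreover have "\<not> insert (p (3 * i + 3)) B \<subseteq> insert (p (3 * j + 1)) S" if "i < j" for i
      using prev[OF that] S(2) dist[of i j] that j by auto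
    ultimately show "insert (p (3 * j + 1)) S \<in> L \<and>
        (\<forall>i<j. \<not> insert (p (3 * i + 3)) B \<subseteq> insert (p (3 * j + 1)) S)" by simp
  next
    show "insert (p (3 * j + 3)) B \<noteq> {} \<and> p (3 * j + 1) \<notin> insert (p (3 * j + 3)) B" if "j < J" for j
      using B[OF that] dist[OF that that] by auto
  qed
  also have "{S \<in> L. \<forall>j<J. \<not> insert (p (3 * j + 3)) B \<subseteq> S} =
      {S \<in> L. B \<subseteq> S \<longrightarrow> (\<forall>j<J. p (3 * j + 3) \<notin> S)}" by auto
  finally show ?thesis .
qed

text \<open>
  In the intended situation the link of \<open>B\<close> is the boundary of the cross-polytope on the pairs
  \<open>{a j, b j}\<close> without the facet \<open>{b 0, b 1, \<dots>}\<close>; the faces \<open>B \<union> {b l | l > j}\<close> are removed in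
  the order of increasing \<open>j\<close>, with apex \<open>a j\<close>.
\<close>

lemma collapses_kill:
  fixes a b :: "nat \<Rightarrow> 'a"
  assumes ins: "\<And>S j. S \<in> L \<Longrightarrow> B \<subseteq> S \<Longrightarrow> j < k \<Longrightarrow> b j \<notin> S \<Longrightarrow> insert (a j) S \<in> L"
    and miss: "\<And>S. S \<in> L \<Longrightarrow> B \<subseteq> S \<Longrightarrow> \<exists>j<k. b j \<notin> S"
    and dist: "\<And>i j. i < k \<Longrightarrow> j < k \<Longrightarrow> a i \<noteq> b j" and B: "\<And>j. j < k \<Longrightarrow> a j \<notin> B" "B \<noteq> {}"
  shows "L \<searrow> {S \<in> L. \<not> B \<subseteq> S}"
proof -
  define \<sigma> where "\<sigma> j = B \<union> b ` {j<..<k}" for j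
  have notin: "a j \<notin> \<sigma> i" if "j < k" "i < k" for i j
    unfolding \<sigma>_def image_iff Un_iff Bex_def greaterThanLessThan_iff
    using dist[OF that(1)] B(1)[OF that(1)] by blast
  have "L \<searrow> {S \<in> L. \<forall>j<k. \<not> \<sigma> j \<subseteq> S}"
  proof (rule collapses_sequence[where v = a])
    fix j S assume j: "j < k" and S: "S \<in> L" "\<sigma> j \<subseteq> S" and prev: "\<And>i. i < j \<Longrightarrow> \<not> \<sigma> i \<subseteq> S"
    have BS: "B \<subseteq> S" using S(2) by (auto simp: \<sigma>_def)
    have "b j \<notin> S"
    proof (cases j)
      case 0
      \<comment> \<open>Here \<open>S\<close> contains all \<open>b l\<close> with
        \<open>l > 0\<close>, so the one that \<open>miss\<close> finds missing is
        \<open>b 0\<close>.\<close>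
      obtain l where l: "l < k" "b l \<notin> S" using miss[OF S(1) BS] by auto
      then have "l \<notin> {j<..<k}" using S(2) unfolding \<sigma>_def by blast
      then have "l = 0" using l 0 by simp
      then show ?thesis using l 0 by simp
    next
      case (Suc i)
      then have "{i<..<k} = insert j {j<..<k}" using j by auto
      then have "\<sigma> i = insert (b j) (\<sigma> j)" by (simp add: \<sigma>_def)
      then show ?thesis using prev[of i] S(2) Suc by auto
    qed
    then have "insert (a j) S \<in> L" using ins[OF S(1) BS j] by simp
    moreover have "\<not> \<sigma> i \<subseteq> insert (a j) S" if "i < j" for i
    proof -
      have "a j \<notin> \<sigma> i" using notin[OF j] that j by simp
      then show ?thesis using prev[OF that] by auto
    qed
    ultimately show "insert (a j) S \<in> L \<and> (\<forall>i<j. \<not> \<sigma> i \<subseteq> insert (a j) S)" by simp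
  next
    show "\<sigma> j \<noteq> {} \<and> a j \<notin> \<sigma> j" if "j < k" for j
      using notin[OF that that] B(2) by (auto simp: \<sigma>_def)
  qed
  also have "{S \<in> L. \<forall>j<k. \<not> \<sigma> j \<subseteq> S} = {S \<in> L. \<not> B \<subseteq> S}"
  proof (intro Collect_cong conj_cong refl iffI allI impI)
    fix S assume S: "S \<in> L" "\<forall>j<k. \<not> \<sigma> j \<subseteq> S"
    show "\<not> B \<subseteq> S"
    proof
      assume "B \<subseteq> S"
      then have "k \<noteq> 0" using miss[OF S(1)] by auto
      \<comment> \<open>The last face in the sequence is \<open>B\<close> itself, as no index lies
        strictly between \<open>k - 1\<close> and \<open>k\<close>.\<close>
      then have "\<not> \<sigma> (k - 1) \<subseteq> S" using S(2) by simp
      moreover have "{k - 1<..<k} = {}" by auto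
      ultimately show False using \<open>B \<subseteq> S\<close> by (simp add: \<sigma>_def)
    qed
  qed (auto simp: \<sigma>_def)
  finally show ?thesis .
qed

text \<open>The facets are those of \<open>L\<close> and not of \<open>K\<close>: a face may become
  maximal only because the faces above it have been collapsed away.\<close>

theorem homotopy_equivalent_wedge_collapse:
  assumes K: "simplicial V K" and KL: "K \<searrow> L" and sub: "\<F> \<subseteq> L" and ne: "\<F> \<noteq> {}"
    and max: "\<And>F S. F \<in> \<F> \<Longrightarrow> S \<in> L \<Longrightarrow> F \<subseteq> S \<Longrightarrow> S = F"
    and card: "\<And>F. F \<in> \<F> \<Longrightarrow> card F = Suc d"
    and AC: "L - \<F> \<searrow> C" and cone: "{a} \<in> C" "\<And>S. S \<in> C \<Longrightarrow> insert a S \<in> C"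
  shows "geom_realization V K homotopy_equivalent_space wedge_spheres (card \<F>) d"
proof -
  have L: "simplicial V L" "geom_realization V K homotopy_equivalent_space geom_realization V L"
    using collapses_homotopy_equivalent[OF KL K] by auto
  interpret facet_complex V L \<F> d
    by unfold_locales (use L(1) sub max card in auto)
  have C: "simplicial V C" "geom_realization V A homotopy_equivalent_space geom_realization V C"
    using collapses_homotopy_equivalent[OF AC simplicial_A[unfolded A_def]] by (auto simp: A_def)
  have "contractible_space (geom_realization V A)"
    using contractible_cone(1)[OF C(1) cone] homotopy_equivalent_space_contractibility[OF C(2)] by simp
  moreover have "points V A \<noteq> {}"
    using contractible_cone(2)[OF C(1) cone] collapses_subset[OF AC] by (auto simp: points_def A_def)
  ultimately have "geom_realization V L homotopy_equivalent_space wedge_spheres (card \<F>) d"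
    by (intro homotopy_equivalent_wedge ne)
  then show ?thesis
    using L(2) homotopy_eqv_trans by blast
qed

subsection \<open>The matching complex of a wheel\<close>

locale wheel =
  fixes m :: nat
  assumes m: "3 \<le> m"
begin

text \<open>Rim edges \<open>c\<close> and spokes \<open>s\<close>, indexed modulo \<open>m\<close>; \<open>s a\<close> meets the rim edges \<open>c (a - 1)\<close> and \<open>c a\<close>.\<close>

definition c :: "nat \<Rightarrow> nat set" where "c a = {a mod m + 1, Suc a mod m + 1}"

definition s :: "nat \<Rightarrow> nat set" where "s a = {0, a mod m + 1}"

definition K :: "nat set set set" where "K = matching_complex (wheel_edges (m + 1))"

lemma Suc_mod_cancel: "Suc a mod m = Suc b mod m \<longleftrightarrow> a mod m = b mod m"
  using m by (simp add: mod_Suc)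

lemma add_mod_cancel: "(i + x) mod m = (i + y) mod m \<longleftrightarrow> x mod m = y mod m"
  by (induction i) (simp_all add: Suc_mod_cancel)

lemma c_cong: "a mod m = b mod m \<Longrightarrow> c a = c b"
  unfolding c_def using Suc_mod_cancel[of a b] by simp

lemma s_cong: "a mod m = b mod m \<Longrightarrow> s a = s b"
  by (simp add: s_def)

lemma s_eq_iff: "s a = s b \<longleftrightarrow> a mod m = b mod m"
  by (auto simp: s_def doubleton_eq_iff)

lemma c_eq_iff: "c a = c b \<longleftrightarrow> a mod m = b mod m"
proof
  assume "c a = c b"
  then consider "a mod m = b mod m" | "a mod m = Suc b mod m" "Suc a mod m = b mod m"
    by (auto simp: c_def doubleton_eq_iff)
  then show "a mod m = b mod m"
  proof cases
    \<comment> \<open>Equal edges with exchanged endpoints would force \<open>b + 2\<close> and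
      \<open>b\<close> to agree modulo \<open>m\<close>, which \<open>m \<ge> 3\<close>
      excludes.\<close>
    case 2
    then have "(b + 2) mod m = (b + 0) mod m"
      using Suc_mod_cancel[of a "Suc b"] by simp
    then show ?thesis using m unfolding add_mod_cancel by simp
  qed
qed (rule c_cong)

lemma c_rel: "x < m \<Longrightarrow> y < m \<Longrightarrow> c (i + x) = c (i + y) \<longleftrightarrow> x = y"
  by (simp add: c_eq_iff add_mod_cancel)

lemma s_inj: "x < m \<Longrightarrow> y < m \<Longrightarrow> s x = s y \<longleftrightarrow> x = y"
  by (simp add: s_eq_iff)

lemma c_neq_s: "c a \<noteq> s b" "s b \<noteq> c a"
proof -
  have "0 \<in> s b" "0 \<notin> c a" by (simp_all add: c_def s_def)
  then show "c a \<noteq> s b" "s b \<noteq> c a" by metis+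
qed

lemma c_neq_Suc: "c a \<noteq> c (Suc a)" "c (Suc a) \<noteq> c a"
proof -
  have "(0 = (1::nat)) = (c (a + 0) = c (a + 1))"
    by (rule c_rel[symmetric]) (use m in auto)
  then show "c a \<noteq> c (Suc a)" "c (Suc a) \<noteq> c a" by auto
qed

lemma c_cover: "\<exists>l<m. c a = c (i + l)"
proof -
  \<comment> \<open>Adding \<open>i * m\<close> first keeps the subtraction of \<open>i\<close> from
    being truncated.\<close>
  have "i \<le> i * m" using m by simp
  then have "i + (a + i * m - i) = a + i * m" by linarith
  then have "(i + (a + i * m - i) mod m) mod m = (a + i * m) mod m"
    by (simp only: mod_add_right_eq)
  then have "c a = c (i + (a + i * m - i) mod m)"
    by (intro c_cong) simp
  then show ?thesis using m by (intro exI[of _ "(a + i * m - i) mod m"]) simp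
qed

lemma s_cover: "\<exists>i<m. s a = s i"
  using m by (intro exI[of _ "a mod m"]) (simp add: s_eq_iff)

lemma wheel_edges_eq: "wheel_edges (m + 1) = range c \<union> range s"
proof (intro equalityI subsetI)
  fix e assume "e \<in> wheel_edges (m + 1)"
  then show "e \<in> range c \<union> range s"
    unfolding wheel_edges_def
  proof (elim UnE CollectE exE conjE singletonE)
    fix i assume "e = {0, i}" "1 \<le> i" "i \<le> m + 1 - 1"
    then have "e = s (i - 1)" by (simp add: s_def)
    then show ?thesis by simp
  next
    fix i assume "e = {i, i + 1}" "1 \<le> i" "i < m + 1 - 1"
    then have "e = c (i - 1)" by (simp add: c_def)
    then show ?thesis by simp
  next
    assume "e = {m + 1 - 1, 1}"
    then have "e = c (m - 1)" using m by (simp add: c_def)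
    then show ?thesis by simp
  qed
next
  have spoke: "{0, i} \<in> wheel_edges (m + 1)" if "1 \<le> i" "i \<le> m" for i
    unfolding wheel_edges_def by (rule UnI1, rule UnI1, rule CollectI, rule exI[of _ i]) (use that in simp)
  have rim: "{i, i + 1} \<in> wheel_edges (m + 1)" if "1 \<le> i" "i < m" for i
    unfolding wheel_edges_def by (rule UnI1, rule UnI2, rule CollectI, rule exI[of _ i]) (use that in simp)
  have last: "{m, 1} \<in> wheel_edges (m + 1)"
    unfolding wheel_edges_def by (rule UnI2) simp
  fix e assume "e \<in> range c \<union> range s"
  then show "e \<in> wheel_edges (m + 1)"
  proof
    assume "e \<in> range c"
    then obtain a where "e = c a" by (rule rangeE)
    then obtain l where l: "l < m" "e = c l" using c_cover[of a 0] by auto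
    show ?thesis
    proof (cases "Suc l < m")
      case True
      then have "e = {l + 1, l + 1 + 1}" using l by (simp add: c_def)
      then show ?thesis using rim[of "l + 1"] True by simp
    next
      case False
      then have "Suc l = m" using l by simp
      then have "e = {m, 1}" using l by (auto simp: c_def)
      then show ?thesis using last by simp
    qed
  next
    assume "e \<in> range s"
    then obtain a where "e = s a" by (rule rangeE)
    moreover have "a mod m < m" using m by simp
    ultimately show ?thesis using spoke[of "a mod m + 1"] by (simp add: s_def)
  qed
qed

text \<open>Disjointness is replaced by a list of forbidden pairs. Indices range over all natural
  numbers, so the closing of the rim cycle requires no separate case.\<close>

lemma K_iff:
  "S \<in> K \<longleftrightarrow> S \<noteq> {} \<and> S \<subseteq> range c \<union> range s \<and> (\<forall>a. c a \<in> S \<longrightarrow> c (Suc a) \<notin> S) \<and>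
     (\<forall>a. s a \<in> S \<longrightarrow> c a \<notin> S) \<and> (\<forall>a. s (Suc a) \<in> S \<longrightarrow> c a \<notin> S) \<and>
     (\<forall>a b. s a \<in> S \<longrightarrow> s b \<in> S \<longrightarrow> s a = s b)"
  (is "_ \<longleftrightarrow> _ \<and> _ \<and> ?P")
proof -
  have "(\<forall>e\<in>S. \<forall>e'\<in>S. e \<noteq> e' \<longrightarrow> e \<inter> e' = {}) \<longleftrightarrow> ?P" if S: "S \<subseteq> range c \<union> range s"
  proof
    assume disj: "\<forall>e\<in>S. \<forall>e'\<in>S. e \<noteq> e' \<longrightarrow> e \<inter> e' = {}"
    have D: "e = e'" if "e \<in> S" "e' \<in> S" "x \<in> e" "x \<in> e'" for e e' x
      using disj that by blast
    show ?P
    proof (intro conjI allI impI notI)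
      fix a assume "c a \<in> S" "c (Suc a) \<in> S"
      then have "c a = c (Suc a)" by (rule D[of _ _ "Suc a mod m + 1"]) (simp_all add: c_def)
      then show False using c_neq_Suc by simp
    next
      fix a assume "s a \<in> S" "c a \<in> S"
      then have "s a = c a" by (rule D[of _ _ "a mod m + 1"]) (simp_all add: c_def s_def)
      then show False using c_neq_s by simp
    next
      fix a assume "s (Suc a) \<in> S" "c a \<in> S"
      then have "s (Suc a) = c a" by (rule D[of _ _ "Suc a mod m + 1"]) (simp_all add: c_def s_def)
      then show False using c_neq_s by simp
    next
      fix a b assume "s a \<in> S" "s b \<in> S"
      then show "s a = s b" by (rule D[of _ _ 0]) (simp_all add: s_def)
    qed
  next
    assume P: ?P
    have cc: "c a = c b" if ab: "c a \<in> S" "c b \<in> S" and ne: "c a \<inter> c b \<noteq> {}" for a b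
    proof (rule ccontr)
      assume "c a \<noteq> c b"
      then have "a mod m = Suc b mod m \<or> Suc a mod m = b mod m"
        using ne by (auto simp: c_def c_eq_iff Suc_mod_cancel)
      then have "c a = c (Suc b) \<or> c b = c (Suc a)" using c_cong by metis
      then show False using P ab by metis
    qed
    have sc: "s a \<inter> c b = {}" if ab: "s a \<in> S" "c b \<in> S" for a b
    proof (rule ccontr)
      assume "s a \<inter> c b \<noteq> {}"
      then have "a mod m = b mod m \<or> a mod m = Suc b mod m" by (auto simp: c_def s_def)
      then have "s a = s b \<or> s a = s (Suc b)" by (auto simp: s_eq_iff)
      then show False using P ab by metis
    qed
    show "\<forall>e\<in>S. \<forall>e'\<in>S. e \<noteq> e' \<longrightarrow> e \<inter> e' = {}"
    proof (intro ballI impI)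
      fix e e' assume e: "e \<in> S" "e' \<in> S" "e \<noteq> e'"
      have "(\<exists>a. e = c a) \<or> (\<exists>a. e = s a)" "(\<exists>b. e' = c b) \<or> (\<exists>b. e' = s b)"
        using subsetD[OF S e(1)] subsetD[OF S e(2)] unfolding Un_iff image_iff by simp_all
      then consider a b where "e = c a" "e' = c b" | a b where "e = c a" "e' = s b"
        | a b where "e = s a" "e' = c b" | a b where "e = s a" "e' = s b"
        by metis
      then show "e \<inter> e' = {}"
      proof cases
        case (1 a b) then show ?thesis using cc[of a b] e by auto
      next
        case (2 a b) then show ?thesis using sc[of b a] e by (simp add: Int_commute)
      next
        case (3 a b) then show ?thesis using sc[of a b] e by simp
      next
        case (4 a b)
        then have "e = e'" using P e(1,2) by metis
        then show ?thesis using e(3) by simp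
      qed
    qed
  qed
  then show ?thesis
    unfolding K_def matching_complex_def is_matching_def wheel_edges_eq mem_Collect_eq
    by (intro conj_cong refl) simp
qed

lemma simplicial_K: "simplicial (wheel_edges (m + 1)) K"
  unfolding simplicial_def
proof (intro conjI)
  have "finite {{0, i} | i. 1 \<le> i \<and> i \<le> m}" "finite {{i, i + 1} | i. 1 \<le> i \<and> i < m}"
    by (rule finite_subset[of _ "Pow {0..m}"]; auto)+
  then show "finite (wheel_edges (m + 1))"
    by (simp add: wheel_edges_def)
  show "\<forall>S\<in>K. S \<noteq> {} \<and> S \<subseteq> wheel_edges (m + 1)"
    by (auto simp: K_def matching_complex_def is_matching_def)
  show "\<forall>S\<in>K. Pow S - {{}} \<subseteq> K"
  proof (intro ballI subsetI)
    fix S T assume "S \<in> K" and "T \<in> Pow S - {{}}"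
    then have S: "S \<subseteq> wheel_edges (m + 1)" "\<forall>e\<in>S. \<forall>e'\<in>S. e \<noteq> e' \<longrightarrow> e \<inter> e' = {}"
      and T: "T \<noteq> {}" "T \<subseteq> S"
      unfolding K_def matching_complex_def is_matching_def by simp_all
    have "\<forall>e\<in>T. \<forall>e'\<in>T. e \<noteq> e' \<longrightarrow> e \<inter> e' = {}"
      using S(2) T(2) by (meson subsetD)
    then show "T \<in> K"
      using S(1) T unfolding K_def matching_complex_def is_matching_def by simp
  qed
qed

lemma K_conflict:
  assumes "S \<in> K"
  shows "c a \<in> S \<Longrightarrow> b = Suc a \<Longrightarrow> c b \<notin> S" "c b \<in> S \<Longrightarrow> b = Suc a \<Longrightarrow> c a \<notin> S"
    "s a \<in> S \<Longrightarrow> c a \<notin> S" "s b \<in> S \<Longrightarrow> b = Suc a \<Longrightarrow> c a \<notin> S"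
    "s a \<in> S \<Longrightarrow> s b \<in> S \<Longrightarrow> s a = s b"
  using assms unfolding K_iff by blast+

text \<open>The four excluded edges are precisely the other edges that share an endpoint with
  \<open>c y\<close>. The successors are named by equations so that instances may give the indices
  in any arithmetic form.\<close>

lemma insert_c:
  assumes S: "S \<in> K" and y: "y = Suc x" "z = Suc y"
    and x: "c x \<notin> S" "c z \<notin> S" "s y \<notin> S" "s z \<notin> S"
  shows "insert (c y) S \<in> K"
  unfolding K_iff
proof (intro conjI allI impI)
  note conf = K_conflict[OF S]
  show "insert (c y) S \<subseteq> range c \<union> range s" using S unfolding K_iff by auto
  fix a
  show "c (Suc a) \<notin> insert (c y) S" if "c a \<in> insert (c y) S"
  proof
    assume "c (Suc a) \<in> insert (c y) S"
    then consider "c (Suc a) = c y" | "c (Suc a) \<in> S" by auto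
    then show False
    proof cases
      case 1
      then have "c a = c x" unfolding y(1) c_eq_iff Suc_mod_cancel .
      then show False using that x(1) c_neq_Suc y(1) by auto
    next
      case 2
      then have "c a = c y" using that conf(2)[OF 2 refl] by auto
      then have "c (Suc a) = c z" unfolding y(2) c_eq_iff Suc_mod_cancel .
      then show False using 2 x(2) by simp
    qed
  qed
  show "c a \<notin> insert (c y) S" if "s a \<in> insert (c y) S"
  proof
    assume "c a \<in> insert (c y) S"
    moreover have "s a \<in> S" using that c_neq_s by auto
    ultimately have "c a = c y" "s a \<in> S" using conf(3) by auto
    then show False using x(3) s_cong[of a y] by (simp add: c_eq_iff)
  qed
  show "c a \<notin> insert (c y) S" if "s (Suc a) \<in> insert (c y) S"
  proof
    assume "c a \<in> insert (c y) S"
    moreover have "s (Suc a) \<in> S" using that c_neq_s by auto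
    ultimately have "c a = c y" "s (Suc a) \<in> S" using conf(4)[OF _ refl] by auto
    then show False using x(4) s_cong[of "Suc a" z] by (simp add: c_eq_iff Suc_mod_cancel y(2))
  qed
  show "s a = s b" if "s a \<in> insert (c y) S" "s b \<in> insert (c y) S" for b
    using that conf(5)[of a b] c_neq_s[of y a] c_neq_s[of y b] by simp
qed simp

lemma insert_s:
  assumes S: "S \<in> K" and y: "y = Suc x"
    and x: "c x \<notin> S" "c y \<notin> S" and sp: "\<And>a. s a \<in> S \<Longrightarrow> s a = s y"
  shows "insert (s y) S \<in> K"
  unfolding K_iff
proof (intro conjI allI impI)
  note conf = K_conflict[OF S]
  show "insert (s y) S \<subseteq> range c \<union> range s" using S unfolding K_iff by auto
  fix a
  show "c (Suc a) \<notin> insert (s y) S" if "c a \<in> insert (s y) S"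
    using that conf(1)[OF _ refl, of a] c_neq_s[of a y] c_neq_s[of "Suc a" y] by simp
  show "c a \<notin> insert (s y) S" if "s a \<in> insert (s y) S"
  proof -
    have "s a = s y" using that sp by auto
    then have "c a = c y" by (intro c_cong) (simp add: s_eq_iff)
    then show ?thesis using x(2) c_neq_s by simp
  qed
  show "c a \<notin> insert (s y) S" if "s (Suc a) \<in> insert (s y) S"
  proof -
    have "s (Suc a) = s y" using that sp by auto
    then have "c a = c x" by (intro c_cong) (simp add: s_eq_iff y Suc_mod_cancel)
    then show ?thesis using x(1) c_neq_s by simp
  qed
  show "s a = s b" if "s a \<in> insert (s y) S" "s b \<in> insert (s y) S" for b
    using that sp[of a] sp[of b] by auto
qed simp

lemma c_add_m: "c (i + m) = c i" "c m = c 0"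
  by (intro c_cong; simp)+

lemma s_add_m: "s (i + m) = s i" "s m = s 0"
  by (intro s_cong; simp)+

lemma K_cases:
  assumes "S \<in> K" "e \<in> S"
  obtains (rim) x where "x < m" "e = c (i + x)" | (spoke) a where "a < m" "e = s a"
proof -
  have "S \<subseteq> range c \<union> range s"
    by (rule K_iff[THEN iffD1, THEN conjunct2, THEN conjunct1]) (rule assms(1))
  then have "e \<in> range c \<union> range s" using assms(2) by (rule subsetD)
  then show thesis
  proof
    assume "e \<in> range c"
    then obtain a where "e = c a" by (rule rangeE)
    moreover obtain x where "x < m" "c a = c (i + x)" using c_cover by metis
    ultimately show thesis by (intro rim) simp_all
  next
    assume "e \<in> range s"
    then obtain a where "e = s a" by (rule rangeE)
    moreover obtain b where "b < m" "s a = s b" using s_cover by metis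
    ultimately show thesis by (intro spoke) simp_all
  qed
qed

lemma s_rel: "0 < x \<Longrightarrow> x < m \<Longrightarrow> s (i + x) \<noteq> s i"
  using add_mod_cancel[of i x 0] by (simp add: s_eq_iff)

text \<open>The rim edge preceding \<open>s i\<close> is \<open>c (i - 1)\<close>, which as an
  offset from \<open>i\<close> is \<open>c (i + (m - 1))\<close>.\<close>

lemma K_neighbour_wrap: "S \<in> K \<Longrightarrow> s i \<in> S \<Longrightarrow> m = Suc x \<Longrightarrow> c (i + x) \<notin> S"
  using K_conflict(4)[of S "i + m" "i + x"] s_add_m by simp

section \<open>Folding and killing the links of spokes\<close>

lemma spoke_insert:
  assumes S: "S \<in> K" "s i \<in> S" and y: "y = Suc x" "z = Suc y" "z < m"
    and "c (i + x) \<notin> S" "c (i + z) \<notin> S"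
  shows "insert (c (i + y)) S \<in> K"
proof (rule insert_c[OF S(1), of "i + y" "i + x" "i + z"])
  show "s (i + y) \<notin> S" "s (i + z) \<notin> S"
    using K_conflict(5)[OF S(1,2)] s_rel[of y i] s_rel[of z i] y by force+
qed (use assms in auto)

text \<open>In the link of \<open>s i\<close>, the path
  \<open>c (i + 1), ..., c (i + (m - 2))\<close>, every third vertex is dropped. The bound
  \<open>i0\<close> serves to spare \<open>s 0\<close> when it is 1.\<close>

definition spoke_folded :: "nat \<Rightarrow> nat \<Rightarrow> nat set set set" where
  "spoke_folded i0 J =
     {S \<in> K. \<forall>i. i0 \<le> i \<longrightarrow> i < m \<longrightarrow> s i \<in> S \<longrightarrow> (\<forall>j<J. c (i + (3 * j + 3)) \<notin> S)}"

text \<open>The spokes can be treated one after the other, since a face contains at most one spoke: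
  inserting an apex into a face with \<open>s n\<close> cannot violate the condition attached to
  another spoke.\<close>

lemma collapses_spoke_folded:
  assumes J: "3 * J + 2 \<le> m"
  shows "K \<searrow> spoke_folded i0 J"
proof -
  define C where
    "C n = {S \<in> K. \<forall>i. i0 \<le> i \<longrightarrow> i < n \<longrightarrow> s i \<in> S \<longrightarrow> (\<forall>j<J. c (i + (3 * j + 3)) \<notin> S)}" for n
  have "C 0 \<searrow> C m"
  proof (rule collapses_chain)
    fix n assume n: "n < m"
    show "C n \<searrow> C (Suc n)"
    proof (cases "i0 \<le> n")
      case False
      then have "C (Suc n) = C n" by (auto simp: C_def less_Suc_eq)
      then show ?thesis by (simp add: collapses_refl)
    next
      case True
      have "C n \<searrow> {S \<in> C n. {s n} \<subseteq> S \<longrightarrow> (\<forall>j<J. c (n + (3 * j + 3)) \<notin> S)}"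
      proof (rule collapses_fold[where p = "\<lambda>l. c (n + l)"])
        fix S j assume S: "S \<in> C n" "{s n} \<subseteq> S" and j: "j < J"
          and c: "c (n + (3 * j + 3)) \<in> S" "c (n + 3 * j) \<notin> S"
        have SK: "S \<in> K" and sn: "s n \<in> S" using S by (auto simp: C_def)
        have "c (n + (3 * j + 2)) \<notin> S"
          by (rule K_conflict(2)[OF SK c(1)]) simp
        then have "insert (c (n + (3 * j + 1))) S \<in> K"
          using c(2) j J by (intro spoke_insert[OF SK sn, of _ "3 * j" "3 * j + 2"]) auto
        moreover have "s i \<notin> insert (c (n + (3 * j + 1))) S" if "i < n" for i
          using K_conflict(5)[OF SK sn, of i] s_inj[of n i] that n c_neq_s by auto
        ultimately show "insert (c (n + (3 * j + 1))) S \<in> C n"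
          unfolding C_def by blast
      next
        show "c (n + 0) \<notin> S" if "S \<in> C n" "{s n} \<subseteq> S" for S
          using K_conflict(3)[of S n] that by (auto simp: C_def)
        show "c (n + (3 * j + 1)) \<notin> {s n}" for j
          using c_neq_s by simp
        show "c (n + (3 * i + 3)) \<noteq> c (n + (3 * j + 1))" if "i < J" "j < J" for i j
          using J that by (subst c_rel) (simp_all, presburger)
      qed
      also have "{S \<in> C n. {s n} \<subseteq> S \<longrightarrow> (\<forall>j<J. c (n + (3 * j + 3)) \<notin> S)} = C (Suc n)"
        using True by (auto simp: C_def less_Suc_eq)
      finally show ?thesis .
    qed
  qed
  then show ?thesis by (simp add: C_def spoke_folded_def)
qed

text \<open>The spoke with the second vertex of each pair
  \<open>{c (i + (3 * j + 1)), c (i + (3 * j + 2))}\<close> of its folded link, that is, one facet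
  of the cross-polytope boundary joined with \<open>s i\<close>.\<close>

definition spoke_facet :: "nat \<Rightarrow> nat \<Rightarrow> nat set set" where
  "spoke_facet k i = insert (s i) ((\<lambda>j. c (i + (3 * j + 2))) ` {..<k})"

lemma s_in_spoke_facet: "s a \<in> spoke_facet k i \<longleftrightarrow> s a = s i"
  using c_neq_s by (auto simp: spoke_facet_def)

lemma c_in_spoke_facet:
  assumes "3 * k < m" "x < m"
  shows "c (i + x) \<in> spoke_facet k i \<longleftrightarrow> (\<exists>j<k. x = 3 * j + 2)"
proof -
  have "c (i + x) = c (i + (3 * j + 2)) \<longleftrightarrow> x = 3 * j + 2" if "j < k" for j
    using that assms by (intro c_rel) auto
  then show ?thesis
    using c_neq_s by (auto simp: spoke_facet_def)
qed

lemma spoke_facet_in_K: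
  assumes k: "3 * k < m"
  shows "spoke_facet k i \<in> K"
  unfolding K_iff
proof (intro conjI allI impI)
  show "spoke_facet k i \<subseteq> range c \<union> range s" by (auto simp: spoke_facet_def)
  fix a
  obtain x where x: "x < m" "c a = c (i + x)" using c_cover[of a i] by auto
  have x': "c (Suc a) = c (i + Suc x)"
    using x(2) by (simp add: c_eq_iff Suc_mod_cancel)
  show "c (Suc a) \<notin> spoke_facet k i" if ca: "c a \<in> spoke_facet k i"
  proof -
    have "c (i + x) \<in> spoke_facet k i" using ca x(2) by simp
    then obtain j where j: "j < k" "x = 3 * j + 2"
      using c_in_spoke_facet[OF k x(1), of i] by metis
    then show ?thesis
      unfolding x' using k by (subst c_in_spoke_facet[OF k]) (auto, presburger)
  qed
  show "c a \<notin> spoke_facet k i" if "s a \<in> spoke_facet k i"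
  proof -
    have "c a = c (i + 0)" using that by (intro c_cong) (simp add: s_in_spoke_facet s_eq_iff)
    then show ?thesis using c_in_spoke_facet[OF k, of 0 i] m by auto
  qed
  show "c a \<notin> spoke_facet k i" if "s (Suc a) \<in> spoke_facet k i"
  proof -
    have "Suc a mod m = Suc (i + (m - 1)) mod m"
      using that m by (simp add: s_in_spoke_facet s_eq_iff)
    then have "c a = c (i + (m - 1))" unfolding Suc_mod_cancel by (rule c_cong)
    then show ?thesis using c_in_spoke_facet[OF k, of "m - 1" i] m k by auto
  qed
  show "s a = s b" if "s a \<in> spoke_facet k i" "s b \<in> spoke_facet k i" for b
    using that by (simp add: s_in_spoke_facet)
qed (simp add: spoke_facet_def)

text \<open>A rim edge compatible with \<open>s i\<close> has an offset between 1 and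
  \<open>m - 2 \<le> 3 * k\<close>. These offsets are covered by the blocks
  \<open>3 * j + 1, 3 * j + 2, 3 * j + 3\<close> with \<open>j < k\<close>, and in each block the
  middle edge belongs to the facet and excludes the two others.\<close>

lemma spoke_facet_maximal:
  assumes k: "3 * k < m" "m \<le> 3 * k + 2" and S: "S \<in> K" "spoke_facet k i \<subseteq> S"
  shows "S = spoke_facet k i"
proof (intro antisym S(2) subsetI)
  fix e assume e: "e \<in> S"
  have si: "s i \<in> S" using S(2) by (auto simp: spoke_facet_def)
  have ci: "c (i + (3 * j + 2)) \<in> S" if "j < k" for j using S(2) that by (auto simp: spoke_facet_def)
  from S(1) e show "e \<in> spoke_facet k i"
  proof (cases rule: K_cases[where i = i])
    case x: (rim x)
    have "x \<noteq> 0"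
    proof
      assume "x = 0"
      then have "e = c i" using x(2) by simp
      then show False using K_conflict(3)[OF S(1) si] e by simp
    qed
    have "x \<noteq> m - 1" using K_neighbour_wrap[OF S(1) si, of "m - 1"] e x(2) m by auto
    have n1: "x \<noteq> 3 * j + 1" if "j < k" for j
    proof
      assume "x = 3 * j + 1"
      then have "c (i + (3 * j + 1)) \<in> S" using e x(2) by simp
      moreover have "c (i + (3 * j + 1)) \<notin> S" by (rule K_conflict(2)[OF S(1) ci[OF that]]) simp
      ultimately show False by simp
    qed
    have n3: "x \<noteq> 3 * j + 3" if "j < k" for j
    proof
      assume "x = 3 * j + 3"
      then have "c (i + (3 * j + 3)) \<in> S" using e x(2) by simp
      moreover have "c (i + (3 * j + 3)) \<notin> S" by (rule K_conflict(1)[OF S(1) ci[OF that]]) simp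
      ultimately show False by simp
    qed
    define j r where "j = (x - 1) div 3" and "r = (x - 1) mod 3"
    then have r: "x - 1 = 3 * j + r" "r < 3" by simp_all
    then have "x = 3 * j + 1 \<or> x = 3 * j + 2 \<or> x = 3 * j + 3" and "j < k"
      using \<open>x \<noteq> 0\<close> \<open>x \<noteq> m - 1\<close> k x(1) by linarith+
    then have "\<exists>j<k. x = 3 * j + 2"
      using n1[of j] n3[of j] by (intro exI[of _ j]) simp
    then show ?thesis using c_in_spoke_facet[OF k(1) x(1)] x(2) by simp
  next
    case (spoke a)
    then show ?thesis using K_conflict(5)[OF S(1) si, of a] e by (simp add: s_in_spoke_facet)
  qed
qed

lemma card_spoke_facet:
  assumes "3 * k < m"
  shows "card (spoke_facet k i) = Suc k"
proof -
  have "inj_on (\<lambda>j. c (i + (3 * j + 2))) {..<k}"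
    using assms by (intro inj_onI) (subst (asm) c_rel, auto)
  moreover have "s i \<notin> (\<lambda>j. c (i + (3 * j + 2))) ` {..<k}" using c_neq_s by auto
  ultimately show ?thesis by (simp add: spoke_facet_def card_image)
qed

text \<open>The bounds leave \<open>J = k - 1\<close> and \<open>J = k\<close>, for
  \<open>m = 3 k + 1\<close> and \<open>m = 3 k + 2\<close>; either way the vertices between
  consecutive pairs are folded. \<open>G\<close> carries along spokeless facets that are removed at
  the same time: every face handled here contains a spoke, so they do not interfere. The folding
  conditions disappear together with the spokes to which they refer.\<close>

lemma collapses_spokes_kill:
  assumes k: "3 * k < m" "m \<le> 3 * k + 2" and J: "k \<le> Suc J" "3 * J + 2 \<le> m"
    and G: "\<And>T a. T \<in> G \<Longrightarrow> s a \<notin> T"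
  shows "spoke_folded i0 J - (spoke_facet k ` {i0..<m} \<union> G) \<searrow>
     {S \<in> K. (\<forall>i. i0 \<le> i \<longrightarrow> i < m \<longrightarrow> s i \<notin> S) \<and> S \<notin> G}"
proof -
  define A where "A = spoke_folded i0 J - (spoke_facet k ` {i0..<m} \<union> G)"
  define C where "C n = {S \<in> A. \<forall>i. i0 \<le> i \<longrightarrow> i < n \<longrightarrow> s i \<notin> S}" for n
  have "C 0 \<searrow> C m"
  proof (rule collapses_chain)
    fix n assume n: "n < m"
    show "C n \<searrow> C (Suc n)"
    proof (cases "i0 \<le> n")
      case False
      then have "C (Suc n) = C n" by (auto simp: C_def less_Suc_eq)
      then show ?thesis by (simp add: collapses_refl)
    next
      case True
      have "C n \<searrow> {S \<in> C n. \<not> {s n} \<subseteq> S}"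
      proof (rule collapses_kill[where a = "\<lambda>j. c (n + (3 * j + 1))" and b = "\<lambda>j. c (n + (3 * j + 2))" and k = k])
        fix S assume S: "S \<in> C n" "{s n} \<subseteq> S"
        have SK: "S \<in> K" and sn: "s n \<in> S" and SA: "S \<in> A" using S by (auto simp: C_def A_def spoke_folded_def)
        have folded: "c (n + (3 * j + 3)) \<notin> S" if "j < J" for j
          using SA True n sn that by (auto simp: A_def spoke_folded_def)
        show "\<exists>j<k. c (n + (3 * j + 2)) \<notin> S"
        proof (rule ccontr)
          assume "\<not> ?thesis"
          then have "spoke_facet k n \<subseteq> S" using sn by (auto simp: spoke_facet_def)
          then have "S = spoke_facet k n" by (rule spoke_facet_maximal[OF k SK])
          then show False using SA True n by (auto simp: A_def)
        qed
        fix j assume j: "j < k" and b: "c (n + (3 * j + 2)) \<notin> S"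
        let ?T = "insert (c (n + (3 * j + 1))) S"
        have "c (n + 3 * j) \<notin> S"
        proof (cases j)
          case 0 then show ?thesis using K_conflict(3)[OF SK sn] by simp
        next
          case (Suc j')
          then have "3 * j = 3 * j' + 3" "j' < J" using j J by auto
          then show ?thesis using folded[of j'] by (simp only:) simp
        qed
        then have TK: "?T \<in> K"
          using b j k by (intro spoke_insert[OF SK sn, of _ "3 * j" "3 * j + 2"]) auto
        have other: "i = n" if "s i \<in> ?T" "i < m" for i
          using K_conflict(5)[OF SK sn, of i] s_inj[of n i] that n c_neq_s by auto
        have "c (n + (3 * j' + 3)) \<notin> ?T" if "j' < J" for j'
        proof -
          have "c (n + (3 * j' + 3)) \<noteq> c (n + (3 * j + 1))"
            using J k j that by (subst c_rel) (simp_all, presburger)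
          then show ?thesis using folded[OF that] by simp
        qed
        then have "?T \<in> spoke_folded i0 J" using TK other unfolding spoke_folded_def by blast
        \<comment> \<open>Inserting an apex cannot recreate a removed facet: the only spoke present
          is \<open>s n\<close>, and its facet contains no first vertex of a pair.\<close>
        moreover have neF: "?T \<noteq> spoke_facet k i" if "i < m" for i
        proof
          assume T: "?T = spoke_facet k i"
          have "s i \<in> spoke_facet k i" by (simp add: spoke_facet_def)
          then have "i = n" unfolding T[symmetric] by (rule other) (rule that)
          moreover have "c (n + (3 * j + 1)) \<notin> spoke_facet k n"
            using j k by (subst c_in_spoke_facet) (simp_all, presburger)
          ultimately show False using T by blast
        qed
        moreover have "?T \<notin> G" using G[of ?T n] sn by blast
        moreover have "?T \<notin> spoke_facet k ` {i0..<m}"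
          unfolding image_iff using neF by (metis atLeastLessThan_iff)
        ultimately have "?T \<in> A" unfolding A_def by blast
        moreover have "s i \<notin> ?T" if "i < n" for i using other[of i] that n by auto
        ultimately show "?T \<in> C n" unfolding C_def by blast
      next
        show "c (n + (3 * i + 1)) \<noteq> c (n + (3 * j + 2))" if "i < k" "j < k" for i j
          using k that by (subst c_rel) (simp_all, presburger)
      qed (use c_neq_s in auto)
      also have "{S \<in> C n. \<not> {s n} \<subseteq> S} = C (Suc n)"
        using True by (auto simp: C_def less_Suc_eq)
      finally show ?thesis .
    qed
  qed
  moreover have "C m = {S \<in> K. (\<forall>i. i0 \<le> i \<longrightarrow> i < m \<longrightarrow> s i \<notin> S) \<and> S \<notin> G}"
    by (auto simp: C_def A_def spoke_folded_def spoke_facet_def)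
  moreover have "C 0 = A" by (simp add: C_def)
  ultimately show ?thesis unfolding A_def by simp
qed

section \<open>Spokeless faces: the rim cycle and paths in it\<close>

definition rim_facet :: "nat \<Rightarrow> nat \<Rightarrow> nat set set" where
  "rim_facet k r = (\<lambda>j. c (r + 3 * j)) ` {..k}"

lemma s_notin_rim_facet: "s a \<notin> rim_facet k r"
  using c_neq_s by (auto simp: rim_facet_def)

lemma c_in_rim_facet:
  assumes "3 * k < m" "x < m"
  shows "c (r + x) \<in> rim_facet k r \<longleftrightarrow> (\<exists>j\<le>k. x = 3 * j)"
proof -
  have "c (r + x) = c (r + 3 * j) \<longleftrightarrow> x = 3 * j" if "j \<le> k" for j
    using that assms by (intro c_rel) auto
  then show ?thesis by (auto simp: rim_facet_def)
qed

text \<open>If \<open>m\<close> were \<open>3 * k + 1\<close>, the last edge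
  \<open>c (r + 3 * k)\<close> would meet \<open>c r\<close> around the cycle.\<close>

lemma rim_facet_in_K:
  assumes k: "3 * k + 1 < m"
  shows "rim_facet k r \<in> K"
  unfolding K_iff
proof (intro conjI allI impI)
  have k': "3 * k < m" using k by simp
  show "rim_facet k r \<noteq> {}" "rim_facet k r \<subseteq> range c \<union> range s" by (auto simp: rim_facet_def)
  fix a
  obtain x where x: "x < m" "c a = c (r + x)" using c_cover by metis
  have x': "c (Suc a) = c (r + Suc x)"
    using x(2) by (simp add: c_eq_iff Suc_mod_cancel)
  show "c (Suc a) \<notin> rim_facet k r" if ca: "c a \<in> rim_facet k r"
  proof -
    have "c (r + x) \<in> rim_facet k r" using ca x(2) by simp
    then obtain j where j: "j \<le> k" "x = 3 * j"
      using c_in_rim_facet[OF k' x(1), of r] by metis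
    then have "Suc x < m" using k by linarith
    moreover have "Suc x \<noteq> 3 * j'" for j' using j(2) by presburger
    ultimately show ?thesis
      unfolding x' using c_in_rim_facet[OF k', of "Suc x" r] by metis
  qed
qed (simp_all add: s_notin_rim_facet)

text \<open>Split the offsets into blocks \<open>3 * j, 3 * j + 1, 3 * j + 2\<close>. The second
  edge meets the first one; the third meets the first edge of the next block, which for
  \<open>j = k\<close> is \<open>c r\<close> again because then \<open>m = 3 * k + 3\<close>. Spokes
  are excluded since one may fit into a gap between two chosen edges.\<close>

lemma rim_facet_maximal:
  assumes k: "3 * k < m" "m \<le> 3 * k + 3" and S: "S \<in> K" "rim_facet k r \<subseteq> S"
    and e: "e \<in> S" "\<And>a. a < m \<Longrightarrow> e \<noteq> s a"
  shows "e \<in> rim_facet k r"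
proof -
  have cr: "c (r + 3 * j) \<in> S" if "j \<le> k" for j using S(2) that by (auto simp: rim_facet_def)
  from S(1) e(1) show "e \<in> rim_facet k r"
  proof (cases rule: K_cases[where i = r])
    case x: (rim x)
    define j q where "j = x div 3" and "q = x mod 3"
    then have q: "x = 3 * j + q" "q < 3" by simp_all
    have j: "j \<le> k" using q x(1) k by linarith
    have "q \<noteq> 1"
    proof
      assume "q = 1"
      have "c (r + x) \<notin> S" by (rule K_conflict(1)[OF S(1) cr[OF j]]) (simp add: q(1) \<open>q = 1\<close>)
      then show False using e(1) x(2) by simp
    qed
    moreover have "q \<noteq> 2"
    proof
      assume q2: "q = 2"
      have "c (r + Suc x) \<in> S"
      proof (cases "j < k")
        case True
        have "Suc x = 3 * (j + 1)" using q(1) q2 by simp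
        moreover have "c (r + 3 * (j + 1)) \<in> S" using True by (intro cr) simp
        ultimately show ?thesis by (simp only:)
      next
        case False
        then have "Suc x = m" using j q(1) q2 x(1) k by linarith
        then have "c (r + Suc x) = c (r + 3 * 0)" by (simp add: c_add_m)
        then show ?thesis using cr[of 0] by simp
      qed
      then have "c (r + x) \<notin> S" by (rule K_conflict(2)[OF S(1)]) simp
      then show False using e(1) x(2) by simp
    qed
    ultimately have "x = 3 * j" using q by linarith
    then show ?thesis using x j by (auto simp: rim_facet_def)
  qed (use e(2) in auto)
qed

lemma card_rim_facet:
  assumes "3 * k < m"
  shows "card (rim_facet k r) = Suc k"
proof -
  have "inj_on (\<lambda>j. c (r + 3 * j)) {..k}"
    using assms by (intro inj_onI) (subst (asm) c_rel, auto)
  then show ?thesis by (simp add: rim_facet_def card_image)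
qed

text \<open>Without spokes the link of \<open>c r\<close> lies in the path
  \<open>c (r + 2), ..., c (r + (m - 2))\<close>, here \<open>p 1, p 2, ...\<close>, and the edges
  \<open>p (3 * j + 2)\<close> together with \<open>c r\<close> form the rim facet. Only the
  \<open>k - 1\<close> vertices between consecutive pairs are folded. For
  \<open>m = 3 * k + 3\<close> a vertex \<open>p (3 * k)\<close> follows the last pair; it does not
  disturb the apexes, as \<open>p (3 * j + 1)\<close> has only the neighbours
  \<open>p (3 * j)\<close> and \<open>p (3 * j + 2)\<close>.\<close>

lemma collapses_rim_kill:
  assumes k: "3 * k < m"
    and LK: "\<And>S. S \<in> L \<Longrightarrow> S \<in> K" "\<And>S a. S \<in> L \<Longrightarrow> s a \<notin> S"
    and ins: "\<And>S j. S \<in> L \<Longrightarrow> c r \<in> S \<Longrightarrow> j < k \<Longrightarrow> insert (c (r + (3 * j + 2))) S \<in> K \<Longrightarrow>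
      insert (c (r + (3 * j + 2))) S \<in> L"
    and miss: "\<And>S. S \<in> L \<Longrightarrow> \<not> rim_facet k r \<subseteq> S"
  shows "L \<searrow> {S \<in> L. c r \<notin> S}"
proof -
  define p where "p l = c (r + (l + 1))" for l
  have p_rel: "p x \<noteq> p y" if "x + 1 < m" "y + 1 < m" "x \<noteq> y" for x y
    using c_rel[of "x + 1" "y + 1" r] that by (simp add: p_def)
  have p_r: "p x \<noteq> c r" if "x + 1 < m" for x
    using c_rel[of "x + 1" 0 r] that by (simp add: p_def)
  have p_insert: "insert (p (3 * j + 1)) S \<in> L"
    if "S \<in> L" "c r \<in> S" "j < k" "p (3 * j) \<notin> S" "p (3 * j + 2) \<notin> S" for S j
  proof -
    have "insert (p (3 * j + 1)) S \<in> K"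
      unfolding p_def
      by (rule insert_c[of S _ "r + (3 * j + 1)" "r + (3 * j + 2 + 1)"])
        (use that LK in \<open>auto simp: p_def\<close>)
    then show ?thesis using ins[OF that(1-3)] by (simp add: p_def)
  qed
  have p0: "p 0 \<notin> S" if "S \<in> L" "c r \<in> S" for S
    unfolding p_def by (rule K_conflict(1)[OF LK(1)[OF that(1)] that(2)]) simp
  define L' where "L' = {S \<in> L. {c r} \<subseteq> S \<longrightarrow> (\<forall>j<k - 1. p (3 * j + 3) \<notin> S)}"
  have "L \<searrow> L'"
    unfolding L'_def
  proof (rule collapses_fold)
    fix S j assume S: "S \<in> L" "{c r} \<subseteq> S" and j: "j < k - 1" and p: "p (3 * j + 3) \<in> S" "p (3 * j) \<notin> S"
    have "p (3 * j + 2) \<notin> S"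
      unfolding p_def by (rule K_conflict(2)[OF LK(1)[OF S(1)] p(1)[unfolded p_def]]) simp
    then show "insert (p (3 * j + 1)) S \<in> L"
      using S j p by (intro p_insert) auto
  next
    show "p (3 * j + 1) \<notin> {c r}" if "j < k - 1" for j
      using p_r[of "3 * j + 1"] that k by simp
    show "p (3 * i + 3) \<noteq> p (3 * j + 1)" if "i < k - 1" "j < k - 1" for i j
    proof (rule p_rel)
      show "3 * i + 3 \<noteq> 3 * j + 1" by presburger
    qed (use that k in auto)
  qed (use p0 in auto)
  moreover have "L' \<searrow> {S \<in> L'. \<not> {c r} \<subseteq> S}"
  proof (rule collapses_kill[where a = "\<lambda>j. p (3 * j + 1)" and b = "\<lambda>j. p (3 * j + 2)" and k = k])
    fix S assume S: "S \<in> L'" "{c r} \<subseteq> S"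
    have SL: "S \<in> L" and cr: "c r \<in> S" and folded: "\<And>j. j < k - 1 \<Longrightarrow> p (3 * j + 3) \<notin> S"
      using S by (auto simp: L'_def)
    show "\<exists>j<k. p (3 * j + 2) \<notin> S"
    proof (rule ccontr)
      assume "\<not> ?thesis"
      then have b: "p (3 * j + 2) \<in> S" if "j < k" for j using that by blast
      have "c (r + 3 * j) \<in> S" if "j \<le> k" for j
      proof (cases j)
        case 0 then show ?thesis using cr by simp
      next
        case (Suc j')
        then have "3 * j = 3 * j' + 2 + 1" by simp
        then show ?thesis using b[of j'] Suc that by (simp only: p_def add.assoc)
      qed
      then show False using miss[OF SL] by (auto simp: rim_facet_def)
    qed
    fix j assume j: "j < k" and b: "p (3 * j + 2) \<notin> S"
    have "p (3 * j) \<notin> S"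
    proof (cases j)
      case 0 then show ?thesis using p0[OF SL cr] by simp
    next
      case (Suc j')
      then have "3 * j = 3 * j' + 3" "j' < k - 1" using j by auto
      then show ?thesis using folded[of j'] by (simp only:) simp
    qed
    then have "insert (p (3 * j + 1)) S \<in> L" using SL cr j b by (intro p_insert)
    moreover have "p (3 * i + 3) \<noteq> p (3 * j + 1)" if "i < k - 1" for i
    proof (rule p_rel)
      show "3 * i + 3 \<noteq> 3 * j + 1" by presburger
    qed (use that j k in auto)
    ultimately show "insert (p (3 * j + 1)) S \<in> L'"
      using folded by (auto simp: L'_def)
  next
    show "p (3 * i + 1) \<noteq> p (3 * j + 2)" if "i < k" "j < k" for i j
    proof (rule p_rel)
      show "3 * i + 1 \<noteq> 3 * j + 2" by presburger
    qed (use that k in auto)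
    show "p (3 * j + 1) \<notin> {c r}" if "j < k" for j
      using p_r[of "3 * j + 1"] that k by simp
  qed simp
  moreover have "{S \<in> L'. \<not> {c r} \<subseteq> S} = {S \<in> L. c r \<notin> S}"
    by (auto simp: L'_def)
  ultimately show ?thesis using collapses_trans by metis
qed

lemma singleton_in_K: "{c a} \<in> K" "{s a} \<in> K"
proof -
  have "rim_facet 0 a = {c a}" by (simp add: rim_facet_def)
  then show "{c a} \<in> K" using rim_facet_in_K[of 0 a] m by simp
  have "spoke_facet 0 a = {s a}" by (simp add: spoke_facet_def)
  then show "{s a} \<in> K" using spoke_facet_in_K[of 0 a] m by simp
qed

text \<open>A path with \<open>3 * J + 1\<close> vertices: after folding, both neighbours of its
  last vertex are gone, so this vertex is an apex. The option \<open>S = {}\<close> in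
  \<open>ins\<close> provides the apex as a face, the empty set not being one.\<close>

lemma collapses_rim_path:
  assumes J: "3 * J + 1 < m"
    and LK: "\<And>S. S \<in> L \<Longrightarrow> S \<in> K" "\<And>S a. S \<in> L \<Longrightarrow> s a \<notin> S"
    and ends: "\<And>S. S \<in> L \<Longrightarrow> c q \<notin> S" "\<And>S. S \<in> L \<Longrightarrow> c (q + (3 * J + 2)) \<notin> S"
    and ins: "\<And>S j. S \<in> L \<or> S = {} \<Longrightarrow> j \<le> J \<Longrightarrow> insert (c (q + (3 * j + 1))) S \<in> K \<Longrightarrow>
      insert (c (q + (3 * j + 1))) S \<in> L"
  obtains C a where "L \<searrow> C" "{a} \<in> C" "\<And>S. S \<in> C \<Longrightarrow> insert a S \<in> C"
proof
  define p where "p l = c (q + l)" for l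
  \<comment> \<open>The vacuous premise \<open>{} \<subseteq> S\<close> matches
    \<open>collapses_fold\<close> for \<open>B = {}\<close>.\<close>
  define C where "C = {S \<in> L. {} \<subseteq> S \<longrightarrow> (\<forall>j<J. p (3 * j + 3) \<notin> S)}"
  have p_rel: "p x \<noteq> p y" if "x < m" "y < m" "x \<noteq> y" for x y
    using c_rel[of x y q] that by (simp add: p_def)
  have p_insert: "insert (p (3 * j + 1)) S \<in> L"
    if "S \<in> L" "j \<le> J" "p (3 * j) \<notin> S" "p (3 * j + 2) \<notin> S" for S j
  proof -
    have "insert (p (3 * j + 1)) S \<in> K"
      unfolding p_def
      by (rule insert_c[of S _ "q + 3 * j" "q + (3 * j + 2)"])
        (use that LK in \<open>auto simp: p_def\<close>)
    then show ?thesis using ins that by (simp add: p_def)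
  qed
  have dist: "p (3 * i + 3) \<noteq> p (3 * j + 1)" if "i < J" "j \<le> J" for i j
  proof (rule p_rel)
    show "3 * i + 3 \<noteq> 3 * j + 1" by presburger
  qed (use that J in auto)
  show "L \<searrow> C"
    unfolding C_def
  proof (rule collapses_fold)
    fix S j assume S: "S \<in> L" and j: "j < J" and p: "p (3 * j + 3) \<in> S" "p (3 * j) \<notin> S"
    have "p (3 * j + 2) \<notin> S"
      unfolding p_def by (rule K_conflict(2)[OF LK(1)[OF S(1)] p(1)[unfolded p_def]]) simp
    then show "insert (p (3 * j + 1)) S \<in> L"
      using S j p by (intro p_insert) auto
  qed (use ends dist in \<open>auto simp: p_def\<close>)
  have new: "insert (p (3 * J + 1)) S \<in> C" if "insert (p (3 * J + 1)) S \<in> L" "\<And>j. j < J \<Longrightarrow> p (3 * j + 3) \<notin> S" for S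
    using that dist[of _ J] by (auto simp: C_def)
  have "insert (p (3 * J + 1)) {} \<in> L"
    using ins[of "{}" J] singleton_in_K by (simp add: p_def)
  then show "{p (3 * J + 1)} \<in> C" by (rule new) simp
  show "insert (p (3 * J + 1)) S \<in> C" if "S \<in> C" for S
  proof (rule new)
    have S: "S \<in> L" and folded: "\<And>j. j < J \<Longrightarrow> p (3 * j + 3) \<notin> S" using that by (auto simp: C_def)
    have "p (3 * J) \<notin> S"
    proof (cases J)
      case 0 then show ?thesis using ends(1)[OF S] by (simp add: p_def)
    next
      case (Suc j')
      then have "3 * J = 3 * j' + 3" "j' < J" by auto
      then show ?thesis using folded[of j'] by (simp only:) simp
    qed
    then show "insert (p (3 * J + 1)) S \<in> L"
      using S ends(2)[OF S] by (intro p_insert) (auto simp: p_def)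
  qed (use that in \<open>auto simp: C_def\<close>)
qed

section \<open>The three residues of the rim length\<close>

lemma K_spokeless:
  "{S \<in> K. \<forall>i<m. s i \<notin> S} = {S \<in> K. \<forall>a. s a \<notin> S}"
  using s_cover by metis

lemma spoke_facet_folded:
  assumes k: "3 * k < m" and J: "J \<le> k"
  shows "spoke_facet k i \<in> spoke_folded i0 J"
proof -
  have "c (i' + (3 * j + 3)) \<notin> spoke_facet k i" if "i' < m" "s i' \<in> spoke_facet k i" "j < J" for i' j
  proof -
    have "c (i' + (3 * j + 3)) = c (i + (3 * j + 3))"
      using that(2) unfolding s_in_spoke_facet s_eq_iff c_eq_iff by (metis mod_add_left_eq)
    moreover have "3 * j + 3 \<noteq> 3 * j' + 2" for j' by presburger
    ultimately show ?thesis using c_in_spoke_facet[OF k, of "3 * j + 3" i] that(3) k J by simp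
  qed
  then show ?thesis using spoke_facet_in_K[OF k] by (simp add: spoke_folded_def)
qed

lemma inj_on_spoke_facet: "inj_on (spoke_facet k) {0..<m}"
proof (rule inj_onI)
  fix i i' assume i: "i \<in> {0..<m}" "i' \<in> {0..<m}" and eq: "spoke_facet k i = spoke_facet k i'"
  have "s i \<in> spoke_facet k i'" unfolding eq[symmetric] by (simp add: s_in_spoke_facet)
  then show "i = i'" using i by (simp add: s_in_spoke_facet s_inj)
qed

lemma rim_facet_eq:
  assumes "3 * k < m" "m \<le> 3 * k + 3" "S \<in> K" "rim_facet k r \<subseteq> S" "\<And>a. a < m \<Longrightarrow> s a \<notin> S"
  shows "S = rim_facet k r"
proof (intro antisym assms(4) subsetI)
  fix e assume e: "e \<in> S"
  have "e \<noteq> s a" if "a < m" for a using assms(5)[OF that] e by metis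
  then show "e \<in> rim_facet k r" by (rule rim_facet_maximal[OF assms(1-4) e])
qed

text \<open>The link of a spoke is a path with \<open>3 * k - 2\<close> vertices, whose last vertex
  becomes an apex; so all spokes go and the rim cycle remains. Without the facets \<open>R 0\<close>
  and \<open>R 1\<close>, the vertices \<open>c 0\<close> and \<open>c 1\<close> can be removed in
  turn, and the path \<open>c 2, ..., c (m - 1)\<close> with \<open>3 * k - 2\<close> vertices
  collapses to a cone.\<close>

lemma wheel_rim_mod_0:
  assumes k: "m = 3 * k"
  shows "geom_realization (wheel_edges (m + 1)) K homotopy_equivalent_space wedge_spheres 2 (k - 1)"
proof -
  define R where "R = rim_facet (k - 1)"
  define Rim where "Rim = {S \<in> K. \<forall>a. s a \<notin> S}"
  have k1: "1 \<le> k" using k m by simp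
  then have k3: "3 * (k - 1) + 1 < m" "3 * (k - 1) < m" "m \<le> 3 * (k - 1) + 3"
    using k by auto
  have K1: "K \<searrow> spoke_folded 0 (k - 1)"
    using k3 by (intro collapses_spoke_folded) auto
  have K2: "spoke_folded 0 (k - 1) \<searrow> Rim"
  proof -
    define C where "C n = {S \<in> spoke_folded 0 (k - 1). \<forall>i<n. s i \<notin> S}" for n
    have "C 0 \<searrow> C m"
    proof (rule collapses_chain)
      fix n assume n: "n < m"
      let ?v = "c (n + (3 * (k - 1) + 1))"
      have "C n \<searrow> {S \<in> C n. \<not> {s n} \<subseteq> S}"
      proof (rule collapses_step)
        show "?v \<notin> {s n}" using c_neq_s by simp
        fix S assume S: "S \<in> C n" "{s n} \<subseteq> S"
        have SK: "S \<in> K" and sn: "s n \<in> S" and nos: "\<And>i. i < n \<Longrightarrow> s i \<notin> S"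
          using S by (auto simp: C_def spoke_folded_def)
        have folded: "c (n + (3 * j + 3)) \<notin> S" if "j < k - 1" for j
          using S n that by (auto simp: C_def spoke_folded_def)
        have "c (n + 3 * (k - 1)) \<notin> S"
        proof (cases "k - 1")
          case 0 then show ?thesis using K_conflict(3)[OF SK sn] by simp
        next
          case (Suc j')
          then have "3 * (k - 1) = 3 * j' + 3" "j' < k - 1" by auto
          then show ?thesis using folded[of j'] by (simp only:) simp
        qed
        \<comment> \<open>The offset is \<open>m - 1\<close>, so this is the rim edge that precedes
          the spoke \<open>s n\<close> and meets it.\<close>
        moreover have "c (n + (3 * (k - 1) + 2)) \<notin> S"
          using k k1 by (intro K_neighbour_wrap[OF SK sn]) auto
        ultimately have TK: "insert ?v S \<in> K"
          using k k1 by (intro spoke_insert[OF SK sn, of _ "3 * (k - 1)" "3 * (k - 1) + 2"]) auto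
        have other: "i = n" if "s i \<in> insert ?v S" "i < m" for i
          using K_conflict(5)[OF SK sn, of i] s_inj[of n i] that n c_neq_s by auto
        have "c (n + (3 * j + 3)) \<notin> insert ?v S" if "j < k - 1" for j
        proof -
          have "3 * j + 3 \<noteq> 3 * (k - 1) + 1" by presburger
          then have "c (n + (3 * j + 3)) \<noteq> ?v"
            using k3 that by (subst c_rel) auto
          then show ?thesis using folded[OF that] by simp
        qed
        then have "insert ?v S \<in> spoke_folded 0 (k - 1)"
          using TK other unfolding spoke_folded_def by blast
        moreover have "s i \<notin> insert ?v S" if "i < n" for i using nos[OF that] c_neq_s by simp
        ultimately show "insert ?v S \<in> C n" unfolding C_def by blast
      qed simp
      also have "{S \<in> C n. \<not> {s n} \<subseteq> S} = C (Suc n)"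
        by (auto simp: C_def less_Suc_eq)
      finally show "C n \<searrow> C (Suc n)" .
    qed
    moreover have "C 0 = spoke_folded 0 (k - 1)" by (simp add: C_def)
    moreover have "C m = Rim"
      unfolding Rim_def K_spokeless[symmetric] by (auto simp: C_def spoke_folded_def)
    ultimately show ?thesis by simp
  qed
  have R_Rim: "R r \<in> Rim" for r
    using rim_facet_in_K[OF k3(1)] s_notin_rim_facet by (auto simp: Rim_def R_def)
  have R_max: "S = R r" if "S \<in> Rim" "R r \<subseteq> S" for S r
    using that unfolding R_def Rim_def by (intro rim_facet_eq[OF k3(2,3)]) auto
  have c_in_R: "c (r + x) \<in> R r \<longleftrightarrow> (\<exists>j\<le>k - 1. x = 3 * j)" if "x < m" for r x
    using c_in_rim_facet[OF k3(2) that] by (simp add: R_def)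
  have c0R: "c 0 \<in> R 0" and c1R: "c 1 \<in> R 1"
    using c_in_R[of 0 0] c_in_R[of 0 1] m by auto
  \<comment> \<open>Seen from \<open>c 1\<close>, the edge \<open>c 0\<close> has offset
    \<open>3 * k - 1\<close>. This separates \<open>R 0\<close> from \<open>R 1\<close> and shows
    that no face with \<open>c 0\<close> can grow into \<open>R 1\<close>.\<close>
  have c0R1: "c 0 \<notin> R 1"
  proof -
    have "c 0 = c (1 + (m - 1))" using m c_add_m by simp
    moreover have "m - 1 \<noteq> 3 * j" for j using k k1 by presburger
    ultimately show ?thesis using c_in_R[of "m - 1" 1] m by auto
  qed
  define A where "A = Rim - {R 0, R 1}"
  have A: "S \<in> K" "s a \<notin> S" if "S \<in> A" for S a using that by (auto simp: A_def Rim_def)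
  have insA: "insert (c x) S \<in> A"
    if "S \<in> A \<or> S = {}" "insert (c x) S \<in> K" "insert (c x) S \<noteq> R 0" "insert (c x) S \<noteq> R 1" for x S
  proof -
    have "s a \<notin> insert (c x) S" for a using that(1) A(2)[of S a] c_neq_s by auto
    then show ?thesis using that(2-4) by (simp add: A_def Rim_def)
  qed
  have "A \<searrow> {S \<in> A. c 0 \<notin> S}"
  proof (rule collapses_rim_kill[OF k3(2)])
    show "\<not> rim_facet (k - 1) 0 \<subseteq> S" if "S \<in> A" for S
      using R_max[of S 0] that by (auto simp: A_def R_def)
    fix S j assume S: "S \<in> A" "c 0 \<in> S" and j: "j < k - 1" and K: "insert (c (0 + (3 * j + 2))) S \<in> K"
    have "3 * j + 2 \<noteq> 3 * i" for i by presburger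
    then have "c (0 + (3 * j + 2)) \<notin> R 0" using c_in_R[of "3 * j + 2" 0] j k by simp
    then have "insert (c (0 + (3 * j + 2))) S \<noteq> R 0" by (metis insertI1)
    moreover have "insert (c (0 + (3 * j + 2))) S \<noteq> R 1" using S(2) c0R1 by (metis insertI2)
    ultimately show "insert (c (0 + (3 * j + 2))) S \<in> A"
      using S(1) by (intro insA K) simp_all
  qed (use A in auto)
  moreover have "{S \<in> A. c 0 \<notin> S} \<searrow> {S \<in> {S \<in> A. c 0 \<notin> S}. c 1 \<notin> S}"
  proof (rule collapses_rim_kill[OF k3(2)])
    show "\<not> rim_facet (k - 1) 1 \<subseteq> S" if "S \<in> {S \<in> A. c 0 \<notin> S}" for S
      using R_max[of S 1] that by (auto simp: A_def R_def)
    fix S j assume S: "S \<in> {S \<in> A. c 0 \<notin> S}" and j: "j < k - 1" and K: "insert (c (1 + (3 * j + 2))) S \<in> K"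
    have "3 * j + 2 \<noteq> 3 * i" for i by presburger
    then have "c (1 + (3 * j + 2)) \<notin> R 1" using c_in_R[of "3 * j + 2" 1] j k by simp
    then have R1: "insert (c (1 + (3 * j + 2))) S \<noteq> R 1" by (metis insertI1)
    have "c (0 + (1 + (3 * j + 2))) \<noteq> c (0 + 0)"
      using j k by (subst c_rel) auto
    then have c0: "c 0 \<notin> insert (c (1 + (3 * j + 2))) S" using S by simp
    then have "insert (c (1 + (3 * j + 2))) S \<noteq> R 0" using c0R by metis
    then have "insert (c (1 + (3 * j + 2))) S \<in> A"
      using R1 S by (intro insA K) simp_all
    then show "insert (c (1 + (3 * j + 2))) S \<in> {S \<in> A. c 0 \<notin> S}"
      using c0 by simp
  qed (use A in auto)
  moreover define L where "L = {S \<in> {S \<in> A. c 0 \<notin> S}. c 1 \<notin> S}"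
  ultimately have AL: "A \<searrow> L" using collapses_trans by metis
  have "3 * (k - 1) + 1 < m" using k3 by simp
  then obtain C a where C: "L \<searrow> C" "{a} \<in> C" "\<And>S. S \<in> C \<Longrightarrow> insert a S \<in> C"
  proof (rule collapses_rim_path[where q = 1])
    show "c 1 \<notin> S" if "S \<in> L" for S using that by (simp add: L_def)
    have "1 + (3 * (k - 1) + 2) = m" using k k1 by simp
    then show "c (1 + (3 * (k - 1) + 2)) \<notin> S" if "S \<in> L" for S
      using that by (simp only: c_add_m) (simp add: L_def)
    fix S j assume S: "S \<in> L \<or> S = {}" and j: "j \<le> k - 1" and K: "insert (c (1 + (3 * j + 1))) S \<in> K"
    have "c (0 + (1 + (3 * j + 1))) \<noteq> c (0 + 0)" "c (0 + (1 + (3 * j + 1))) \<noteq> c (0 + 1)"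
      using j k k1 by (subst c_rel; auto)+
    then have c01: "c 0 \<notin> insert (c (1 + (3 * j + 1))) S" "c 1 \<notin> insert (c (1 + (3 * j + 1))) S"
      using S by (auto simp: L_def)
    then have "insert (c (1 + (3 * j + 1))) S \<noteq> R 0" "insert (c (1 + (3 * j + 1))) S \<noteq> R 1"
      using c0R c1R by metis+
    moreover have "S \<in> A \<or> S = {}" using S by (auto simp: L_def)
    ultimately have "insert (c (1 + (3 * j + 1))) S \<in> A"
      by (intro insA K)
    then show "insert (c (1 + (3 * j + 1))) S \<in> L"
      using c01 by (simp add: L_def)
  qed (use A in \<open>auto simp: L_def\<close>)
  have "geom_realization (wheel_edges (m + 1)) K homotopy_equivalent_space wedge_spheres (card {R 0, R 1}) (k - 1)"
  proof (rule homotopy_equivalent_wedge_collapse[OF simplicial_K collapses_trans[OF K1 K2]])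
    show "{R 0, R 1} \<subseteq> Rim" using R_Rim by simp
    show "S = F" if "F \<in> {R 0, R 1}" "S \<in> Rim" "F \<subseteq> S" for F S
      using R_max[of S] that by auto
    show "card F = Suc (k - 1)" if "F \<in> {R 0, R 1}" for F
      using card_rim_facet[OF k3(2)] that by (auto simp: R_def)
    show "Rim - {R 0, R 1} \<searrow> C"
      using collapses_trans[OF AL C(1)] unfolding A_def .
  qed (use C in auto)
  moreover have "card {R 0, R 1} = 2" using c0R c0R1 by (metis card_2_iff)
  ultimately show ?thesis by simp
qed

text \<open>The link of a spoke is a path with \<open>3 * k\<close> vertices, so each of the
  \<open>m\<close> spokes costs a facet. On the remaining cycle, removing the facet \<open>R\<close>
  allows \<open>c 0\<close> to be removed, and the path \<open>c 1, ..., c (m - 1)\<close> with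
  \<open>3 * k + 1\<close> vertices collapses to a cone.\<close>

lemma wheel_rim_mod_2:
  assumes k: "m = 3 * k + 2"
  shows "geom_realization (wheel_edges (m + 1)) K homotopy_equivalent_space wedge_spheres (m + 1) k"
proof -
  have k1: "1 \<le> k" using k m by simp
  have k3: "3 * k + 1 < m" "3 * k < m" "m \<le> 3 * k + 2" "m \<le> 3 * k + 3" "3 * k + 2 \<le> m"
    using k by auto
  define R where "R = rim_facet k 0"
  define \<F> where "\<F> = spoke_facet k ` {0..<m} \<union> {R}"
  define L where "L = {S \<in> K. (\<forall>i. 0 \<le> i \<longrightarrow> i < m \<longrightarrow> s i \<notin> S) \<and> S \<notin> {R}}"
  have c_in_R: "c x \<in> R \<longleftrightarrow> (\<exists>j\<le>k. x = 3 * j)" if "x < m" for x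
    using c_in_rim_facet[OF k3(2) that, of 0] by (simp add: R_def)
  have L: "S \<in> K" "s a \<notin> S" "S \<noteq> R" if "S \<in> L" for S a
    using that s_cover[of a] by (auto simp: L_def)
  have insL: "insert (c x) S \<in> L" if "S \<in> L \<or> S = {}" "insert (c x) S \<in> K" "insert (c x) S \<noteq> R" for x S
  proof -
    have "s a \<notin> insert (c x) S" for a using that(1) L(2)[of S a] c_neq_s by auto
    then show ?thesis using that(2,3) by (simp add: L_def)
  qed
  have K1: "K \<searrow> spoke_folded 0 k"
    using k3 by (intro collapses_spoke_folded) auto
  have "spoke_folded 0 k - \<F> \<searrow> L"
    unfolding \<F>_def L_def using k3 s_notin_rim_facet by (intro collapses_spokes_kill) (auto simp: R_def)
  moreover have "L \<searrow> {S \<in> L. c 0 \<notin> S}"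
  proof (rule collapses_rim_kill[OF k3(2)])
    show "\<not> rim_facet k 0 \<subseteq> S" if "S \<in> L" for S
    proof
      assume RS: "rim_facet k 0 \<subseteq> S"
      have "S = R"
        unfolding R_def by (rule rim_facet_eq[OF k3(2,4) L(1)[OF that] RS L(2)[OF that]])
      then show False using L(3)[OF that] by simp
    qed
    fix S j assume S: "S \<in> L" and j: "j < k" and K: "insert (c (0 + (3 * j + 2))) S \<in> K"
    have "3 * j + 2 \<noteq> 3 * i" for i by presburger
    then have "c (0 + (3 * j + 2)) \<notin> R" using c_in_R[of "3 * j + 2"] j k by simp
    then have "insert (c (0 + (3 * j + 2))) S \<noteq> R" by (metis insertI1)
    then show "insert (c (0 + (3 * j + 2))) S \<in> L"
      using S by (intro insL K) simp_all
  qed (use L in auto)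
  ultimately have AL: "spoke_folded 0 k - \<F> \<searrow> {S \<in> L. c 0 \<notin> S}" by (rule collapses_trans)
  have c0R: "c 0 \<in> R" using c_in_R[of 0] m by auto
  from k3(1) obtain C a where C: "{S \<in> L. c 0 \<notin> S} \<searrow> C" "{a} \<in> C" "\<And>S. S \<in> C \<Longrightarrow> insert a S \<in> C"
  proof (rule collapses_rim_path[where q = 0])
    have "0 + (3 * k + 2) = m" using k by simp
    then show "c (0 + (3 * k + 2)) \<notin> S" if "S \<in> {S \<in> L. c 0 \<notin> S}" for S
      using that by (simp only: c_add_m) simp
    fix S j assume S: "S \<in> {S \<in> L. c 0 \<notin> S} \<or> S = {}" and j: "j \<le> k" and K: "insert (c (0 + (3 * j + 1))) S \<in> K"
    have "c (0 + (3 * j + 1)) \<noteq> c (0 + 0)"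
      using j k by (subst c_rel) auto
    then have c0: "c 0 \<notin> insert (c (0 + (3 * j + 1))) S"
      using S by auto
    then have "insert (c (0 + (3 * j + 1))) S \<noteq> R" using c0R by metis
    moreover have "S \<in> L \<or> S = {}" using S by auto
    ultimately have "insert (c (0 + (3 * j + 1))) S \<in> L" by (intro insL K)
    then show "insert (c (0 + (3 * j + 1))) S \<in> {S \<in> L. c 0 \<notin> S}"
      using c0 by simp
  qed (use L in auto)
  \<comment> \<open>In \<open>K\<close> the face \<open>R\<close> extends by the spokes
    \<open>s (3 * t + 2)\<close> with \<open>t < k\<close>, which lie in its gaps. From such a spoke
    \<open>c 0\<close> has offset \<open>m - (3 * t + 2) = 3 * (k - t)\<close>, a folded position,
    so these extensions are gone. For \<open>t = 0\<close> this is the last fold, which is why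
    \<open>J = k\<close> is chosen.\<close>
  have R_max: "S = R" if S: "S \<in> spoke_folded 0 k" "R \<subseteq> S" for S
  proof -
    have SK: "S \<in> K" using S by (simp add: spoke_folded_def)
    have RS: "c (3 * j) \<in> S" if "j \<le> k" for j using S(2) that by (auto simp: R_def rim_facet_def)
    have "s i \<notin> S" if i: "i < m" for i
    proof
      assume si: "s i \<in> S"
      define t q where "t = i div 3" and "q = i mod 3"
      then have q: "i = 3 * t + q" "q < 3" by simp_all
      have t: "t \<le> k" using q i k by linarith
      have "q \<noteq> 0"
      proof
        assume "q = 0"
        then show False using K_conflict(3)[OF SK si] RS[OF t] q(1) by simp
      qed
      moreover have "q \<noteq> 1"
      proof
        assume "q = 1"
        then have "c (3 * t) \<notin> S" using q(1) by (intro K_conflict(4)[OF SK si]) simp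
        then show False using RS[OF t] by simp
      qed
      ultimately have q2: "q = 2" using q(2) by simp
      then have "t < k" using q(1) i k by simp
      then have "i + (3 * (k - t - 1) + 3) = 0 + m" using q(1) q2 k by simp
      then have "c (i + (3 * (k - t - 1) + 3)) = c (3 * 0)" by (simp only: c_add_m) simp
      moreover have "c (i + (3 * (k - t - 1) + 3)) \<notin> S"
        using S(1) si i \<open>t < k\<close> by (auto simp: spoke_folded_def)
      ultimately show False using RS[of 0] by simp
    qed
    then show ?thesis
      using S(2) unfolding R_def by (intro rim_facet_eq[OF k3(2,4) SK])
  qed
  have F_max: "S = spoke_facet k i" if "S \<in> spoke_folded 0 k" "spoke_facet k i \<subseteq> S" for S i
    using that by (intro spoke_facet_maximal[OF k3(2,3)]) (auto simp: spoke_folded_def)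
  have F_in: "spoke_facet k i \<in> spoke_folded 0 k" for i
    by (rule spoke_facet_folded[OF k3(2)]) simp
  have R_in: "R \<in> spoke_folded 0 k"
    using rim_facet_in_K[OF k3(1)] s_notin_rim_facet by (simp add: R_def spoke_folded_def)
  have "geom_realization (wheel_edges (m + 1)) K homotopy_equivalent_space wedge_spheres (card \<F>) k"
  proof (rule homotopy_equivalent_wedge_collapse[OF simplicial_K K1])
    show "\<F> \<subseteq> spoke_folded 0 k" "\<F> \<noteq> {}" using F_in R_in by (auto simp: \<F>_def)
    show "S = F" if "F \<in> \<F>" "S \<in> spoke_folded 0 k" "F \<subseteq> S" for F S
      using that R_max[of S] F_max[of S] by (auto simp: \<F>_def)
    show "card F = Suc k" if "F \<in> \<F>" for F
      using card_rim_facet[OF k3(2)] card_spoke_facet[OF k3(2)] that by (auto simp: R_def \<F>_def)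
    show "spoke_folded 0 k - \<F> \<searrow> C"
      by (rule collapses_trans[OF AL C(1)])
  qed (use C in auto)
  moreover have "card \<F> = m + 1"
  proof -
    have "R \<notin> spoke_facet k ` {0..<m}"
    proof
      assume "R \<in> spoke_facet k ` {0..<m}"
      then obtain i where "R = spoke_facet k i" by auto
      then have "s i \<in> R" by (simp add: s_in_spoke_facet)
      then show False using s_notin_rim_facet by (simp add: R_def)
    qed
    then show ?thesis using card_image[OF inj_on_spoke_facet] by (simp add: \<F>_def)
  qed
  ultimately show ?thesis by simp
qed

text \<open>All spokes but \<open>s 0\<close> are removed at the cost of one facet each. A face with
  \<open>c 0\<close> then contains no spoke, so the link of \<open>c 0\<close> is a path with
  \<open>3 * k - 2\<close> vertices and \<open>c 0\<close> goes without cost. Folding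
  \<open>c 3, c 6, ..., c (3 * k)\<close> finally removes \<open>c (m - 1)\<close>, the other rim
  edge meeting \<open>s 0\<close>, which leaves a cone with apex \<open>s 0\<close>.\<close>

lemma wheel_rim_mod_1:
  assumes k: "m = 3 * k + 1"
  shows "geom_realization (wheel_edges (m + 1)) K homotopy_equivalent_space wedge_spheres (m - 1) k"
proof -
  have k1: "1 \<le> k" using k m by simp
  have k3: "3 * k < m" "m \<le> 3 * k + 2" "3 * (k - 1) + 2 \<le> m" "k \<le> Suc (k - 1)"
    using k k1 by auto
  \<comment> \<open>The empty sets here and in \<open>L\<close> match
    \<open>collapses_spokes_kill\<close> for \<open>G = {}\<close>.\<close>
  define \<F> where "\<F> = spoke_facet k ` {1..<m} \<union> {}"
  define L where "L = {S \<in> K. (\<forall>i. 1 \<le> i \<longrightarrow> i < m \<longrightarrow> s i \<notin> S) \<and> S \<notin> {}}"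
  have L: "S \<in> K" "0 < i \<Longrightarrow> i < m \<Longrightarrow> s i \<notin> S" if "S \<in> L" for S i
    using that by (auto simp: L_def)
  have L0: "s a = s 0" if "S \<in> L" "s a \<in> S" for S a
  proof -
    obtain i where "i < m" "s a = s i" using s_cover by metis
    then show ?thesis using L(2)[OF that(1), of i] that(2) by (cases "i = 0") auto
  qed
  have insL: "insert (c x) S \<in> L" if "S \<in> L" "insert (c x) S \<in> K" for x S
  proof -
    have "s i \<notin> insert (c x) S" if "0 < i" "i < m" for i
      using L(2)[OF \<open>S \<in> L\<close> that] c_neq_s by simp
    then show ?thesis using that(2) by (simp add: L_def)
  qed
  have K1: "K \<searrow> spoke_folded 1 (k - 1)"
    using k3 by (intro collapses_spoke_folded) auto
  have KL: "spoke_folded 1 (k - 1) - \<F> \<searrow> L"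
    unfolding \<F>_def L_def using k3 by (intro collapses_spokes_kill) auto
  define L1 where "L1 = {S \<in> L. {c 0} \<subseteq> S \<longrightarrow> (\<forall>j<k - 1. c (1 + (3 * j + 3)) \<notin> S)}"
  have c0_spoke: "s a \<notin> S" if "S \<in> L" "c 0 \<in> S" for S a
    using K_conflict(3)[OF L(1)[OF that(1)], of 0] L0[OF that(1), of a] that(2) by auto
  have LL1: "L \<searrow> L1"
    unfolding L1_def
  proof (rule collapses_fold[where p = "\<lambda>l. c (1 + l)"])
    fix S j assume S: "S \<in> L" "{c 0} \<subseteq> S" and c: "c (1 + (3 * j + 3)) \<in> S" "c (1 + 3 * j) \<notin> S"
    have "c (1 + (3 * j + 2)) \<notin> S"
      by (rule K_conflict(2)[OF L(1)[OF S(1)] c(1)]) simp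
    then show "insert (c (1 + (3 * j + 1))) S \<in> L"
      using S c c0_spoke[OF S(1)]
      by (intro insL insert_c[of S _ "1 + 3 * j" "1 + (3 * j + 2)"] L(1)) auto
  next
    show "c (1 + 0) \<notin> S" if "S \<in> L" "{c 0} \<subseteq> S" for S
      using that by (intro K_conflict(1)[OF L(1), of S 0]) auto
    show "c (1 + (3 * j + 1)) \<notin> {c 0}" if "j < k - 1" for j
      using c_rel[of "1 + (3 * j + 1)" 0 0] that k by simp
    show "c (1 + (3 * i + 3)) \<noteq> c (1 + (3 * j + 1))" if "i < k - 1" "j < k - 1" for i j
      using k that by (subst c_rel) (simp_all, presburger)
  qed
  have L1L2: "L1 \<searrow> {S \<in> L1. \<not> {c 0} \<subseteq> S}"
  proof (rule collapses_step)
    let ?v = "c (1 + (3 * (k - 1) + 1))"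
    show "?v \<notin> {c 0}"
      using c_rel[of "1 + (3 * (k - 1) + 1)" 0 0] k k1 by simp
    fix S assume S: "S \<in> L1" "{c 0} \<subseteq> S"
    have SL: "S \<in> L" and c0: "c 0 \<in> S" and folded: "\<And>j. j < k - 1 \<Longrightarrow> c (1 + (3 * j + 3)) \<notin> S"
      using S by (auto simp: L1_def)
    note SK = L(1)[OF SL]
    have "c (1 + 3 * (k - 1)) \<notin> S"
    proof (cases "k - 1")
      case 0 then show ?thesis using K_conflict(1)[OF SK c0] by simp
    next
      case (Suc j')
      then have "3 * (k - 1) = 3 * j' + 3" "j' < k - 1" by auto
      then show ?thesis using folded[of j'] by (simp only:) simp
    qed
    \<comment> \<open>This edge is \<open>c (m - 1)\<close>, the neighbour of
      \<open>c 0 = c m\<close> across the end of the cycle.\<close>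
    moreover have "c (1 + (3 * (k - 1) + 2)) \<notin> S"
    proof -
      have "c m \<in> S" using c0 c_add_m by simp
      then show ?thesis by (rule K_conflict(2)[OF SK]) (use k k1 in simp)
    qed
    ultimately have "insert ?v S \<in> L"
      using c0_spoke[OF SL c0]
      by (intro insL[OF SL] insert_c[OF SK, of _ "1 + 3 * (k - 1)" "1 + (3 * (k - 1) + 2)"]) auto
    moreover have "c (1 + (3 * j + 3)) \<noteq> ?v" if "j < k - 1" for j
    proof -
      have "1 + (3 * j + 3) \<noteq> 1 + (3 * (k - 1) + 1)" by presburger
      then show ?thesis using k k1 that by (subst c_rel) auto
    qed
    ultimately show "insert ?v S \<in> L1"
      using folded by (auto simp: L1_def)
  qed simp
  have "{S \<in> L1. \<not> {c 0} \<subseteq> S} = {S \<in> L. c 0 \<notin> S}" by (auto simp: L1_def)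
  with L1L2 have L1L2: "L1 \<searrow> {S \<in> L. c 0 \<notin> S}" by simp
  define C where "C = {S \<in> {S \<in> L. c 0 \<notin> S}. {} \<subseteq> S \<longrightarrow> (\<forall>j<k. c (0 + (3 * j + 3)) \<notin> S)}"
  have L2C: "{S \<in> L. c 0 \<notin> S} \<searrow> C"
    unfolding C_def
  proof (rule collapses_fold[where p = "\<lambda>l. c (0 + l)"])
    fix S j assume S: "S \<in> {S \<in> L. c 0 \<notin> S}" and j: "j < k"
      and c: "c (0 + (3 * j + 3)) \<in> S" "c (0 + 3 * j) \<notin> S"
    have SL: "S \<in> L" using S by simp
    have "c (0 + (3 * j + 2)) \<notin> S"
      by (rule K_conflict(2)[OF L(1)[OF SL] c(1)]) simp
    \<comment> \<open>The indices lie between 1 and \<open>m - 1\<close>, so the surviving spoke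
      \<open>s 0\<close> never blocks an apex.\<close>
    moreover have "s (0 + (3 * j + 1)) \<notin> S" "s (0 + (3 * j + 2)) \<notin> S"
      using L(2)[OF SL] j k by auto
    ultimately have "insert (c (0 + (3 * j + 1))) S \<in> L"
      using c(2) by (intro insL[OF SL] insert_c[OF L(1)[OF SL], of _ "0 + 3 * j" "0 + (3 * j + 2)"]) auto
    moreover have "c (0 + (3 * j + 1)) \<noteq> c (0 + 0)"
      using j k by (subst c_rel) auto
    ultimately show "insert (c (0 + (3 * j + 1))) S \<in> {S \<in> L. c 0 \<notin> S}"
      using S by simp
  next
    show "c (0 + (3 * i + 3)) \<noteq> c (0 + (3 * j + 1))" if "i < k" "j < k" for i j
      using k that by (subst c_rel) (simp_all, presburger)
  qed auto
  have sC: "insert (s 0) S \<in> C" if "S \<in> C" for S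
  proof -
    have SL: "S \<in> L" and c0: "c 0 \<notin> S" and folded: "\<And>j. j < k \<Longrightarrow> c (0 + (3 * j + 3)) \<notin> S"
      using that by (auto simp: C_def)
    have "3 * k = 0 + (3 * (k - 1) + 3)" using k1 by simp
    then have "c (3 * k) \<notin> S" using folded[of "k - 1"] k1 by (simp only:) simp
    then have "insert (s m) S \<in> K"
      using c0 L0[OF SL] k c_add_m s_add_m by (intro insert_s[OF L(1)[OF SL], of _ "3 * k"]) auto
    then have "insert (s 0) S \<in> K" using s_add_m by simp
    moreover have "s i \<noteq> s 0" if "0 < i" "i < m" for i using s_inj[of i 0] that by simp
    ultimately show ?thesis
      using SL c0 folded c_neq_s unfolding C_def L_def by auto
  qed
  have s0C: "{s 0} \<in> C"
  proof -
    have "s i \<noteq> s 0" if "0 < i" "i < m" for i using s_inj[of i 0] that by simp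
    then show ?thesis using singleton_in_K c_neq_s unfolding C_def L_def by auto
  qed
  have F_max: "S = spoke_facet k i" if "S \<in> spoke_folded 1 (k - 1)" "spoke_facet k i \<subseteq> S" for S i
    using that by (intro spoke_facet_maximal[OF k3(1,2)]) (auto simp: spoke_folded_def)
  have "geom_realization (wheel_edges (m + 1)) K homotopy_equivalent_space wedge_spheres (card \<F>) k"
  proof (rule homotopy_equivalent_wedge_collapse[OF simplicial_K K1])
    show "\<F> \<subseteq> spoke_folded 1 (k - 1)" using spoke_facet_folded[OF k3(1), of "k - 1"] by (auto simp: \<F>_def)
    show "\<F> \<noteq> {}" using m by (auto simp: \<F>_def)
    show "S = F" if "F \<in> \<F>" "S \<in> spoke_folded 1 (k - 1)" "F \<subseteq> S" for F S
      using that F_max[of S] by (auto simp: \<F>_def)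
    show "card F = Suc k" if "F \<in> \<F>" for F
      using card_spoke_facet[OF k3(1)] that by (auto simp: \<F>_def)
    show "spoke_folded 1 (k - 1) - \<F> \<searrow> C"
      using KL LL1 L1L2 L2C collapses_trans by metis
    show "{s 0} \<in> C" by (rule s0C)
  qed (rule sC)
  moreover have "card \<F> = m - 1"
    using card_image[OF inj_on_subset[OF inj_on_spoke_facet, of "{1..<m}"]] by (simp add: \<F>_def)
  ultimately show ?thesis by simp
qed

end

theorem mainTheorem2:
  fixes n :: nat
  assumes "n \<ge> 4"
  shows "(n mod 3 = 1 \<longrightarrow> (geom_realization (wheel_edges n) (matching_complex (wheel_edges n)))
            homotopy_equivalent_space (wedge_spheres 2 (nu n)))
       \<and> (n mod 3 = 2 \<longrightarrow> (geom_realization (wheel_edges n) (matching_complex (wheel_edges n)))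
            homotopy_equivalent_space (wedge_spheres (n - 2) (nu n)))
       \<and> (n mod 3 = 0 \<longrightarrow> (geom_realization (wheel_edges n) (matching_complex (wheel_edges n)))
            homotopy_equivalent_space (wedge_spheres n (nu n)))"
proof -
  interpret wheel "n - 1" by unfold_locales (use assms in simp)
  have n: "n - 1 + 1 = n" using assms by simp
  have nu: "nu n = d" if "3 * d + 1 < n" "n \<le> 3 * d + 4" for d
  proof -
    have "\<lceil>(real n - 4) / 3\<rceil> = int d"
      using that by (intro ceiling_unique) (simp_all add: field_simps)
    then show ?thesis by (simp add: nu_def)
  qed
  \<comment> \<open>The rim is one shorter than \<open>n\<close>, so the residues shift by one;
    \<open>n = 3 * k\<close> corresponds to \<open>m = 3 * (k - 1) + 2\<close>.\<close>
  define k where "k = n div 3"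
  have "n = 3 * k + n mod 3" by (simp add: k_def)
  then consider "n mod 3 = 1" "n = 3 * k + 1" | "n mod 3 = 2" "n = 3 * k + 2" | "n mod 3 = 0" "n = 3 * k"
    by (metis add_0_right mod_less_divisor less_Suc_eq less_2_cases numeral_3_eq_3 One_nat_def Suc_1 zero_less_Suc)
  then show ?thesis
  proof cases
    case 1
    then show ?thesis
      using wheel_rim_mod_0[of k] nu[of "k - 1"] assms unfolding K_def n by simp
  next
    case 2
    then show ?thesis
      using wheel_rim_mod_1[of k] nu[of k] assms unfolding K_def n by simp
  next
    case 3
    then show ?thesis
      using wheel_rim_mod_2[of "k - 1"] nu[of "k - 1"] assms unfolding K_def n by simp
  qed
qed

end
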